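(* (1) Let $G$ be a $k$-edge-connected $n$-vertex graph of diameter $D$, with a $(d,c,\eta,k/2)$-cycle cover satisfying $\eta=O(1)$, $d=O((101k\ln n)^D\cdot\log n)$, and $c=O(k\log^3 n)$ computed in a preprocessing step. Then any distributed algorithm $\mathcal{A}$ can be compiled into an algorithm $\mathcal{A}'$ that is resilient to an eavesdropping adversary listening on at most $k'=O(k/\log n)$ edges in the graph in every round. With high probability this incurs a multiplicative overhead of $\widetilde{O}((101k\ln n)^D\cdot k)$ in the number of rounds. (2) Let $G$ be a $(k,D)$-connected $n$-vertex graph, with a $(d,c,\eta,k)$-cycle cover satisfying $\eta=O(\log n)$, $d=O(D\log^2 n)$, and $c=O(k\log^4 n)$ computed in a preprocessing step. Then any distributed algorithm $\mathcal{A}$ can be compiled into an algorithm $\mathcal{A}'$ that is resilient to an eavesdropping adversary listening on at most $k'=O(k/\log^2 n)$ edges in the graph. With high probability this incurs a multiplicative overhead of $\widetilde{O}(D\cdot k)$ in the number of rounds.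
   Context: A $(d,c,\eta,k)$-cycle cover for a graph $G=(V,E)$ is a collection $\mathcal{C}$ of simple cycles of $G$ satisfying: (Congestion) each edge $e\in E(G)$ appears on at most $c$ cycles of $\mathcal{C}$; ($(k,\eta)$ Covering) for each edge $e\in E(G)$ there is a collection $\mathcal{C}_e=\{C_{e,1},\ldots,C_{e,k}\}\subseteq\mathcal{C}$ of $k$ cycles that contain $e$, such that each edge $e'\in E(G)\setminus\{e\}$ appears on at most $\eta$ cycles of $\mathcal{C}_e$; (Length) each cycle of $\mathcal{C}$ has length at most $d$. A graph $G$ is $(k,D)$-connected if every pair of distinct vertices is connected by $k$ edge-disjoint paths of length at most $D$ each. Distributed algorithms are in the standard CONGEST model: the input graph $G$ (simple) is the communication network; each node has a processor with a unique ID of $O(\log n)$ bits; execution proceeds in synchronous rounds, and in every round each node can send a message of $O(\log n)$ bits to each of its neighbors. An eavesdropping adversary listening on $k'$ edges observes, in each round, all messages sent over a set of at most $k'$ edges of its choice, unknown to the nodes (the set may differ from round to round). $\mathcal{A}'$ is resilient if it has the same output as $\mathcal{A}$ and the adversary learns nothing (information-theoretically) about the messages of $\mathcal{A}$ from what it observes. In the claim, $k'=O(k/\log n)$ (resp. $O(k/\log^2 n)$) refers to a bound of this form with a suitable constant. $k=\Omega(\log n)$ is assumed. $\widetilde{O}$ hides factors polylogarithmic in $n$. "With high probability" means with probability at least $1-1/n^c$ for some constant $c$. *)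

theory Defs
  imports "HOL-Probability.Probability" "HOL-Probability.Product_PMF"
begin

section \<open>Simple graphs, connectivity and cycle covers\<close>

text \<open>Vertices are natural numbers; a vertex is identified with the unique ID of its processor.
  Edges are two-element sets of vertices.\<close>

type_synonym edge = "nat set"

definition simple_graph :: "nat set \<Rightarrow> edge set \<Rightarrow> bool" where
  "simple_graph V E \<longleftrightarrow> finite V \<and> E \<subseteq> {{u, v} | u v. u \<in> V \<and> v \<in> V \<and> u \<noteq> v}"

fun walk_edges :: "nat list \<Rightarrow> edge set" where
  "walk_edges (u # v # p) = insert {u, v} (walk_edges (v # p))"
| "walk_edges _ = {}"

text \<open>A path is given by its list of vertices, so its length is one less than that of the list.\<close>

definition is_path :: "edge set \<Rightarrow> nat \<Rightarrow> nat \<Rightarrow> nat list \<Rightarrow> bool" where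
  "is_path E u v p \<longleftrightarrow>
     p \<noteq> [] \<and> hd p = u \<and> last p = v \<and> distinct p \<and> walk_edges p \<subseteq> E"

definition path_length :: "nat list \<Rightarrow> nat" where
  "path_length p = length p - 1"

definition graph_connected :: "nat set \<Rightarrow> edge set \<Rightarrow> bool" where
  "graph_connected V E \<longleftrightarrow> (\<forall>u\<in>V. \<forall>v\<in>V. \<exists>p. is_path E u v p)"

definition k_edge_connected :: "nat set \<Rightarrow> edge set \<Rightarrow> nat \<Rightarrow> bool" where
  "k_edge_connected V E k \<longleftrightarrow>
     2 \<le> card V \<and> (\<forall>F. F \<subseteq> E \<and> card F < k \<longrightarrow> graph_connected V (E - F))"

text \<open>Meaningful for connected graphs only.\<close>

definition graph_dist :: "edge set \<Rightarrow> nat \<Rightarrow> nat \<Rightarrow> nat" where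
  "graph_dist E u v = (LEAST l. \<exists>p. is_path E u v p \<and> path_length p = l)"

definition graph_diameter :: "nat set \<Rightarrow> edge set \<Rightarrow> nat" where
  "graph_diameter V E = Max {graph_dist E u v | u v. u \<in> V \<and> v \<in> V}"

definition kD_connected :: "nat set \<Rightarrow> edge set \<Rightarrow> nat \<Rightarrow> nat \<Rightarrow> bool" where
  "kD_connected V E k D \<longleftrightarrow>
     (\<forall>u\<in>V. \<forall>v\<in>V. u \<noteq> v \<longrightarrow>
        (\<exists>P. finite P \<and> card P = k \<and>
             (\<forall>p\<in>P. is_path E u v p \<and> path_length p \<le> D) \<and>
             (\<forall>p\<in>P. \<forall>q\<in>P. p \<noteq> q \<longrightarrow> walk_edges p \<inter> walk_edges q = {})))"

text \<open>A simple cycle is identified with its set of edges, so that its length is the cardinality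
  of that set.\<close>

type_synonym cycle = "edge set"

definition simple_cycle :: "edge set \<Rightarrow> cycle \<Rightarrow> bool" where
  "simple_cycle E C \<longleftrightarrow>
     C \<subseteq> E \<and> (\<exists>vs. 3 \<le> length vs \<and> distinct vs \<and> C = walk_edges (vs @ [hd vs]))"

definition cycle_cover ::
  "edge set \<Rightarrow> nat \<Rightarrow> nat \<Rightarrow> nat \<Rightarrow> nat \<Rightarrow> cycle set \<Rightarrow> bool" where
  "cycle_cover E d c \<eta> k \<C> \<longleftrightarrow>
     (\<forall>C\<in>\<C>. simple_cycle E C) \<and>
     (\<forall>e\<in>E. card {C \<in> \<C>. e \<in> C} \<le> c) \<and>
     (\<forall>e\<in>E. \<exists>\<C>e. \<C>e \<subseteq> \<C> \<and> finite \<C>e \<and> card \<C>e = k \<and> (\<forall>C\<in>\<C>e. e \<in> C) \<and>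
        (\<forall>e'\<in>E - {e}. card {C \<in> \<C>e. e' \<in> C} \<le> \<eta>)) \<and>
     (\<forall>C\<in>\<C>. card C \<le> d)"


section \<open>The CONGEST model\<close>

text \<open>Messages are bit strings; the empty string stands for sending nothing.\<close>

type_synonym msg = "bool list"

text \<open>The messages a node has received so far, one entry per elapsed round, each entry indexed
  by the sending neighbour.\<close>

type_synonym history = "(nat \<Rightarrow> msg) list"

text \<open>A (randomized) distributed algorithm is the program executed by every node.  Local
  computation is unbounded, so instead of an explicit local state a program is a function of
  everything the node knows: its ID, the IDs of its neighbours, its local input, its private
  coins and its history.  Each node tosses \<open>coin_bits\<close> independent fair coins.  A node is still
  running as long as \<open>out\<close> is \<open>None\<close>; the first other value is its final output.\<close>

record ('i, 'o) algorithm =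
  coin_bits :: nat
  send :: "nat \<Rightarrow> nat set \<Rightarrow> 'i \<Rightarrow> bool list \<Rightarrow> history \<Rightarrow> nat \<Rightarrow> msg"
  out :: "nat \<Rightarrow> nat set \<Rightarrow> 'i \<Rightarrow> bool list \<Rightarrow> history \<Rightarrow> 'o option"

definition nbrs :: "edge set \<Rightarrow> nat \<Rightarrow> nat set" where
  "nbrs E v = {u. {u, v} \<in> E}"

definition halted ::
  "('i, 'o) algorithm \<Rightarrow> nat \<Rightarrow> nat set \<Rightarrow> 'i \<Rightarrow> bool list \<Rightarrow> history \<Rightarrow> bool" where
  "halted A v N i r h \<longleftrightarrow> (\<exists>t\<le>length h. out A v N i r (take t h) \<noteq> None)"

text \<open>The message from \<open>u\<close> to \<open>v\<close> in the round that follows the histories \<open>H\<close>; \<open>x\<close> and \<open>\<omega>\<close>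
  are the local inputs and the private coins of all nodes.\<close>

definition sent :: "('i, 'o) algorithm \<Rightarrow> edge set \<Rightarrow> (nat \<Rightarrow> 'i) \<Rightarrow> (nat \<Rightarrow> bool list) \<Rightarrow>
    (nat \<Rightarrow> history) \<Rightarrow> nat \<Rightarrow> nat \<Rightarrow> msg" where
  "sent A E x \<omega> H u v =
     (if {u, v} \<in> E \<and> \<not> halted A u (nbrs E u) (x u) (\<omega> u) (H u)
      then send A u (nbrs E u) (x u) (\<omega> u) (H u) v else [])"

primrec histories :: "('i, 'o) algorithm \<Rightarrow> edge set \<Rightarrow> (nat \<Rightarrow> 'i) \<Rightarrow> (nat \<Rightarrow> bool list) \<Rightarrow>
    nat \<Rightarrow> nat \<Rightarrow> history" where
  "histories A E x \<omega> 0 = (\<lambda>v. [])"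
| "histories A E x \<omega> (Suc t) =
     (\<lambda>v. histories A E x \<omega> t v @ [\<lambda>u. sent A E x \<omega> (histories A E x \<omega> t) u v])"

definition messages :: "('i, 'o) algorithm \<Rightarrow> edge set \<Rightarrow> (nat \<Rightarrow> 'i) \<Rightarrow> (nat \<Rightarrow> bool list) \<Rightarrow>
    nat \<Rightarrow> nat \<Rightarrow> nat \<Rightarrow> msg" where
  "messages A E x \<omega> t = sent A E x \<omega> (histories A E x \<omega> t)"

definition out_after :: "('i, 'o) algorithm \<Rightarrow> edge set \<Rightarrow> (nat \<Rightarrow> 'i) \<Rightarrow> (nat \<Rightarrow> bool list) \<Rightarrow>
    nat \<Rightarrow> nat \<Rightarrow> 'o option" where
  "out_after A E x \<omega> t v = out A v (nbrs E v) (x v) (\<omega> v) (histories A E x \<omega> t v)"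

definition halts_within :: "('i, 'o) algorithm \<Rightarrow> nat set \<Rightarrow> edge set \<Rightarrow> (nat \<Rightarrow> 'i) \<Rightarrow>
    (nat \<Rightarrow> bool list) \<Rightarrow> nat \<Rightarrow> bool" where
  "halts_within A V E x \<omega> T \<longleftrightarrow> (\<forall>v\<in>V. \<exists>t\<le>T. out_after A E x \<omega> t v \<noteq> None)"

text \<open>The final output of a node; relevant for halting executions only.\<close>

definition final_output :: "('i, 'o) algorithm \<Rightarrow> edge set \<Rightarrow> (nat \<Rightarrow> 'i) \<Rightarrow>
    (nat \<Rightarrow> bool list) \<Rightarrow> nat \<Rightarrow> 'o option" where
  "final_output A E x \<omega> v =
     out_after A E x \<omega> (LEAST t. out_after A E x \<omega> t v \<noteq> None) v"

definition coins :: "nat set \<Rightarrow> nat \<Rightarrow> (nat \<Rightarrow> bool list) pmf" where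
  "coins V l = Pi_pmf V [] (\<lambda>_. pmf_of_set {bs. length bs = l})"

definition bandwidth_le :: "('i, 'o) algorithm \<Rightarrow> nat set \<Rightarrow> edge set \<Rightarrow> (nat \<Rightarrow> 'i) \<Rightarrow>
    real \<Rightarrow> bool" where
  "bandwidth_le A V E x b \<longleftrightarrow>
     (\<forall>\<omega>\<in>set_pmf (coins V (coin_bits A)). \<forall>t u v. real (length (messages A E x \<omega> t u v)) \<le> b)"

text \<open>An \<open>n\<close>-node network all of whose IDs have at most \<open>b\<close> bits, in the sense that
  they are smaller than \<open>2 powr b\<close>.\<close>

definition network :: "nat set \<Rightarrow> edge set \<Rightarrow> nat \<Rightarrow> real \<Rightarrow> bool" where
  "network V E n b \<longleftrightarrow> simple_graph V E \<and> card V = n \<and> (\<forall>v\<in>V. real v < 2 powr b)"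


section \<open>Eavesdropping and resilience\<close>

text \<open>One round of observations: the messages, in both directions, on the edges listened to.\<close>

type_synonym observation = "nat \<Rightarrow> nat \<Rightarrow> msg option"

definition observe :: "edge set \<Rightarrow> (nat \<Rightarrow> nat \<Rightarrow> msg) \<Rightarrow> observation" where
  "observe F m = (\<lambda>u v. if {u, v} \<in> F then Some (m u v) else None)"

text \<open>The eavesdropper may choose the edges of a round adaptively, from all that it has observed
  in the previous rounds.  Randomized strategies are mixtures of these deterministic ones.\<close>

definition eavesdropper :: "edge set \<Rightarrow> nat \<Rightarrow> (observation list \<Rightarrow> edge set) \<Rightarrow> bool" where
  "eavesdropper E k' \<sigma> \<longleftrightarrow> (\<forall>h. \<sigma> h \<subseteq> E \<and> card (\<sigma> h) \<le> k')"

primrec view :: "(observation list \<Rightarrow> edge set) \<Rightarrow> (nat \<Rightarrow> nat \<Rightarrow> nat \<Rightarrow> msg) \<Rightarrow> nat \<Rightarrow>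
    observation list" where
  "view \<sigma> m 0 = []"
| "view \<sigma> m (Suc t) = view \<sigma> m t @ [observe (\<sigma> (view \<sigma> m t)) (m t)]"

text \<open>After the preprocessing step, node \<open>v\<close> knows exactly the cycles of the cover that pass
  through it.  They are handed to the compiled algorithm as part of its local input.\<close>

definition with_cover :: "cycle set \<Rightarrow> (nat \<Rightarrow> 'i) \<Rightarrow> nat \<Rightarrow> cycle set \<times> 'i" where
  "with_cover \<C> x v = ({C \<in> \<C>. v \<in> \<Union>C}, x v)"

text \<open>\<open>A'\<close> simulates \<open>A\<close>: the first \<open>coin_bits A\<close> coins of a node are the coins of the simulated
  execution of \<open>A\<close>, the remaining ones are additional randomness.  The output must be that of the
  simulated execution.  Secrecy is perfect: whatever the joint distribution \<open>P\<close> of the local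
  inputs, all that the eavesdropper has seen at any time is independent of the messages of \<open>A\<close>.\<close>

definition coins_of :: "('i, 'o) algorithm \<Rightarrow> (nat \<Rightarrow> bool list) \<Rightarrow> nat \<Rightarrow> bool list" where
  "coins_of A \<omega> v = take (coin_bits A) (\<omega> v)"

definition same_output :: "nat set \<Rightarrow> edge set \<Rightarrow> cycle set \<Rightarrow> ('i, 'o) algorithm \<Rightarrow>
    (cycle set \<times> 'i, 'o) algorithm \<Rightarrow> bool" where
  "same_output V E \<C> A A' \<longleftrightarrow>
     (\<forall>x. \<forall>\<omega>\<in>set_pmf (coins V (coin_bits A')).
        (\<exists>T. halts_within A' V E (with_cover \<C> x) \<omega> T) \<and>
        (\<forall>v\<in>V. final_output A' E (with_cover \<C> x) \<omega> v = final_output A E x (coins_of A \<omega>) v))"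

definition learns_nothing :: "nat set \<Rightarrow> edge set \<Rightarrow> cycle set \<Rightarrow> ('i, 'o) algorithm \<Rightarrow>
    (cycle set \<times> 'i, 'o) algorithm \<Rightarrow> (observation list \<Rightarrow> edge set) \<Rightarrow> bool" where
  "learns_nothing V E \<C> A A' \<sigma> \<longleftrightarrow>
     (\<forall>(P :: (nat \<Rightarrow> 'i) pmf) T.
        let run = pair_pmf P (coins V (coin_bits A'));
            secret = (\<lambda>(x, \<omega>). messages A E x (coins_of A \<omega>));
            seen = (\<lambda>(x, \<omega>). view \<sigma> (messages A' E (with_cover \<C> x) \<omega>) T)
        in map_pmf (\<lambda>s. (secret s, seen s)) run =
           pair_pmf (map_pmf secret run) (map_pmf seen run))"

definition resilient :: "nat set \<Rightarrow> edge set \<Rightarrow> cycle set \<Rightarrow> nat \<Rightarrow> ('i, 'o) algorithm \<Rightarrow>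
    (cycle set \<times> 'i, 'o) algorithm \<Rightarrow> bool" where
  "resilient V E \<C> k' A A' \<longleftrightarrow>
     coin_bits A \<le> coin_bits A' \<and> same_output V E \<C> A A' \<and>
     (\<forall>\<sigma>. eavesdropper E k' \<sigma> \<longrightarrow> learns_nothing V E \<C> A A' \<sigma>)"

definition congest_algorithm :: "nat set \<Rightarrow> edge set \<Rightarrow> ('i, 'o) algorithm \<Rightarrow> nat \<Rightarrow>
    real \<Rightarrow> bool" where
  "congest_algorithm V E A R b \<longleftrightarrow>
     (\<forall>x. bandwidth_le A V E x b \<and>
          (\<forall>\<omega>\<in>set_pmf (coins V (coin_bits A)). halts_within A V E x \<omega> R))"

text \<open>\<open>A'\<close> is a compiled version of the \<open>R\<close>-round algorithm \<open>A\<close>: it is resilient against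
  listening on \<open>k'\<close> edges, its messages have at most \<open>b\<close> bits, and with probability at least \<open>q\<close>
  it takes at most \<open>L * R\<close> rounds.\<close>

definition compiled :: "nat set \<Rightarrow> edge set \<Rightarrow> cycle set \<Rightarrow> nat \<Rightarrow> nat \<Rightarrow> real \<Rightarrow> real \<Rightarrow> real \<Rightarrow>
    ('i, 'o) algorithm \<Rightarrow> (cycle set \<times> 'i, 'o) algorithm \<Rightarrow> bool" where
  "compiled V E \<C> k' R b q L A A' \<longleftrightarrow>
     resilient V E \<C> k' A A' \<and>
     (\<forall>x. bandwidth_le A' V E (with_cover \<C> x) b \<and>
          q \<le> measure_pmf.prob (coins V (coin_bits A'))
                {\<omega>. \<exists>T. real T \<le> L * real R \<and> halts_within A' V E (with_cover \<C> x) \<omega> T})"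

end

theory Submission
  imports Defs "HOL-Library.Z2"
begin

text \<open>In a first phase, fresh random bits travel over every edge in each of \<open>8 * S\<close> rounds, where \<open>S\<close> is
  the number of bits that an edge carries in all later rounds. The two ends of the edge condense them
  to \<open>S\<close> key bits by a binary linear code of large distance, so that the keys of an edge are uniform
  as long as it is listened to in at most \<open>S\<close> of these rounds. At most \<open>8 * k'\<close> edges are bad, that is,
  listened to more often. All later traffic is encrypted with these keys and may be taken to be public, so the
  mobile eavesdropper is reduced to one that knows the keys of at most \<open>8 * k'\<close> edges.

  Each bit of a message from \<open>u\<close> to \<open>v\<close> is split additively into one share for each cycle through
  \<open>{u, v}\<close>, which travels around the cycle, and one that travels over the edge itself. A good edge
  protects the latter; for a bad one, some cycle of the cover meets no other bad edge, as each
  bad edge spoils at most \<open>\<eta>\<close> of the cycles covering \<open>{u, v}\<close>. Hence the change from any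
  messages to any others is compensated by a change of random bits that the eavesdropper has not seen. That
  change depends only on what it has seen, so it is an involution of the coins, and the view has
  the same distribution for all messages.\<close>

section \<open>Binary codes as extractors\<close>

text \<open>Sums over \<open>bit\<close> are kept as field operations instead of turning into xor,
  so that linear algebra applies to them.\<close>

declare add_bit_eq_xor [simp del] mult_bit_eq_and [simp del]

text \<open>If row \<open>p\<close> vanished on the common kernel of the rows in \<open>I\<close>,
  it would be a combination of them. So some vector moves row \<open>p\<close> alone, and a multiple
  of it repairs the new equation in a solution for \<open>I\<close>.\<close>

lemma independent_rows_surjective:
  fixes a :: "'q \<Rightarrow> 'j \<Rightarrow> 'f::field"
  assumes "finite I" "finite J"
    and "\<And>l. (\<forall>j\<in>J. (\<Sum>i\<in>I. l i * a i j) = 0) \<Longrightarrow> \<forall>i\<in>I. l i = 0"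
  shows "\<exists>x. \<forall>i\<in>I. (\<Sum>j\<in>J. a i j * x j) = y i"
  using assms(1,3)
proof (induction I arbitrary: y rule: finite_induct)
  case empty
  then show ?case by simp
next
  case (insert p I)
  have ind: "\<forall>i\<in>I. l i = 0" if "\<forall>j\<in>J. (\<Sum>i\<in>I. l i * a i j) = 0" for l
  proof -
    have "(\<Sum>i\<in>insert p I. (l(p := 0)) i * a i j) = (\<Sum>i\<in>I. l i * a i j)" for j
      using insert.hyps by (simp, intro sum.cong) auto
    then have "\<forall>i\<in>insert p I. (l(p := 0)) i = 0"
      using that by (intro insert.prems) simp
    then show ?thesis using insert.hyps by (metis fun_upd_other insertCI)
  qed
  have "\<exists>x. \<forall>i\<in>I. (\<Sum>j\<in>J. a i j * x j) = y i" for y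
    by (rule insert.IH[OF ind])
  then obtain sol where sol: "\<And>y i. i \<in> I \<Longrightarrow> (\<Sum>j\<in>J. a i j * sol y j) = y i"
    by metis
  \<comment> \<open>These vectors are dual to the rows in \<open>I\<close>: row \<open>i\<close>
    takes the value 1 on \<open>D i\<close> and 0 on the others.\<close>
  define D where "D k = sol (\<lambda>i. if i = k then 1 else 0)" for k
  define dot where "dot i x = (\<Sum>j\<in>J. a i j * x j)" for i x
  have "\<exists>z. (\<forall>i\<in>I. dot i z = 0) \<and> dot p z \<noteq> 0"
  proof (rule ccontr)
    assume no: "\<not> ?thesis"
    define l where "l i = (if i = p then 1 else - dot p (D i))" for i
    have "(\<Sum>i\<in>insert p I. l i * a i m) = 0" if m: "m \<in> J" for m
    proof -
      \<comment> \<open>The \<open>m\<close>-th unit vector, corrected by dual vectors until all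
        rows in \<open>I\<close> vanish on it. If row \<open>p\<close> vanishes on it too, its
        \<open>m\<close>-th entry is a combination of the entries of the other rows.\<close>
      define z where "z j = (if j = m then 1 else 0) - (\<Sum>k\<in>I. a k m * D k j)" for j
      have dz: "dot i z = a i m - (\<Sum>k\<in>I. a k m * dot i (D k))" for i
      proof -
        have "dot i z = (\<Sum>j\<in>J. (if j = m then a i j else 0) - (\<Sum>k\<in>I. a k m * (a i j * D k j)))"
          unfolding dot_def z_def
          by (intro sum.cong refl) (auto simp: right_diff_distrib sum_distrib_left mult_ac)
        also have "\<dots> = a i m - (\<Sum>j\<in>J. \<Sum>k\<in>I. a k m * (a i j * D k j))"
          using m assms(2) by (simp add: sum_subtractf)
        also have "(\<Sum>j\<in>J. \<Sum>k\<in>I. a k m * (a i j * D k j)) = (\<Sum>k\<in>I. a k m * dot i (D k))"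
          by (subst sum.swap) (simp add: dot_def sum_distrib_left)
        finally show ?thesis .
      qed
      have "dot i z = 0" if i: "i \<in> I" for i
      proof -
        have "dot i (D k) = (if i = k then 1 else 0)" for k
          unfolding dot_def D_def using sol[OF i] by simp
        then show ?thesis
          unfolding dz using i insert.hyps by (simp add: if_distrib[of "\<lambda>y. _ * y"] cong: if_cong)
      qed
      then have "dot p z = 0" using no by blast
      then have "a p m = (\<Sum>k\<in>I. a k m * dot p (D k))" by (simp add: dz)
      moreover have "(\<Sum>i\<in>I. l i * a i m) = - (\<Sum>k\<in>I. a k m * dot p (D k))"
        unfolding sum_negf[symmetric] using insert.hyps
        by (intro sum.cong) (auto simp: l_def)
      ultimately show ?thesis using insert.hyps by (simp add: l_def)
    qed
    then have "l p = 0" using insert.prems[of l] by blast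
    then show False by (simp add: l_def)
  qed
  then obtain z where z: "\<And>i. i \<in> I \<Longrightarrow> dot i z = 0" "dot p z \<noteq> 0" by blast
  define s where "s = (y p - dot p (sol y)) / dot p z"
  have lin: "dot i (\<lambda>j. sol y j + s * z j) = dot i (sol y) + s * dot i z" for i
    by (simp add: dot_def distrib_left sum.distrib sum_distrib_left mult_ac)
  have "\<forall>i\<in>insert p I. dot i (\<lambda>j. sol y j + s * z j) = y i"
    using z sol by (auto simp: lin) (auto simp: s_def dot_def)
  then show ?case by (intro exI[of _ "\<lambda>j. sol y j + s * z j"]) (simp add: dot_def)
qed

text \<open>Give each set \<open>X\<close> the weight \<open>(1/4) ^ card X\<close>. All subsets
  together weigh \<open>(5/4) ^ (8 * S)\<close>, each small one at least \<open>(1/4) ^ S\<close>,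
  and \<open>(5/4) ^ 8 * 4\<close> is just below 24.\<close>

lemma card_small_subsets_le:
  "real (card {X. X \<subseteq> {..<8 * S} \<and> card X \<le> S}) \<le> 24 ^ S"
proof -
  let ?F = "{X. X \<subseteq> {..<8 * S} \<and> card X \<le> S}"
  have fin: "finite ?F" by (rule finite_subset[of _ "Pow {..<8*S}"]) auto
  have "real (card ?F) * (1/4) ^ S = (\<Sum>X\<in>?F. (1/4) ^ S)" by simp
  also have "\<dots> \<le> (\<Sum>X\<in>?F. (1/4) ^ card X)"
    by (intro sum_mono power_decreasing) auto
  also have "\<dots> \<le> (\<Sum>X\<in>Pow {..<8*S}. (1/4) ^ card X)"
    by (intro sum_mono2) auto
  also have "\<dots> = (\<Prod>i<8*S. 1/4 + (1::real))"
    by (subst prod_add) auto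
  also have "\<dots> = ((5/4) ^ 8) ^ S"
    by (simp add: power_mult)
  finally have "real (card ?F) \<le> ((5/4) ^ 8) ^ S * 4 ^ S"
    by (simp add: field_simps power_divide)
  also have "\<dots> = ((5/4) ^ 8 * 4) ^ S" by (simp only: power_mult_distrib)
  also have "\<dots> \<le> 24 ^ S" by (intro power_mono) (auto simp: power_divide)
  finally show ?thesis .
qed

text \<open>The rows are chosen greedily, each outside the balls of radius \<open>S\<close> around all combinations of
  the earlier ones.\<close>

lemma gilbert_varshamov:
  assumes "s \<le> S"
  shows "\<exists>M :: nat \<Rightarrow> nat \<Rightarrow> bit. \<forall>X l. X \<subseteq> {..<8 * S} \<longrightarrow> card X \<le> S \<longrightarrow>
    (\<forall>j\<in>{..<8 * S} - X. (\<Sum>i<s. l i * M i j) = 0) \<longrightarrow> (\<forall>i<s. l i = 0)"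
  using assms
proof (induction s)
  case 0
  then show ?case by simp
next
  case (Suc s)
  from Suc.IH[OF Suc_leD[OF Suc.prems]]
  obtain M :: "nat \<Rightarrow> nat \<Rightarrow> bit" where "\<forall>X l. X \<subseteq> {..<8 * S} \<longrightarrow> card X \<le> S \<longrightarrow>
    (\<forall>j\<in>{..<8 * S} - X. (\<Sum>i<s. l i * M i j) = 0) \<longrightarrow> (\<forall>i<s. l i = 0)" ..
  then have M: "l i = 0" if "X \<subseteq> {..<8 * S}" "card X \<le> S"
    "\<forall>j\<in>{..<8 * S} - X. (\<Sum>i<s. l i * M i j) = 0" "i < s" for X l i
    using that by blast
  let ?F = "{X. X \<subseteq> {..<8 * S} \<and> card X \<le> S}"
  \<comment> \<open>\<open>?g (L, X)\<close> is the support of the sum of the rows in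
    \<open>L\<close> with the positions in \<open>X\<close> flipped; these words make up the balls
    to be avoided.\<close>
  let ?g = "\<lambda>(L, X). {j. j < 8 * S \<and> ((\<Sum>i\<in>L. M i j) = 1) \<noteq> (j \<in> X)}"
  have fin: "finite ?F" by (rule finite_subset[of _ "Pow {..<8*S}"]) auto
  \<comment> \<open>At most \<open>48 ^ S\<close> of the \<open>256 ^ S\<close> words are excluded;
    strictness holds because \<open>S\<close> is positive here.\<close>
  have "real (card (?g ` (Pow {..<s} \<times> ?F))) \<le> real (card (Pow {..<s} \<times> ?F))"
    using fin by (intro of_nat_mono card_image_le) auto
  also have "\<dots> \<le> 2 ^ s * 24 ^ S"
    using card_small_subsets_le[of S] by (simp add: card_cartesian_product card_Pow)
  also have "\<dots> \<le> 2 ^ S * 24 ^ S" using Suc.prems by (simp add: power_increasing)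
  also have "\<dots> = 48 ^ S" by (simp flip: power_mult_distrib)
  also have "\<dots> < 256 ^ S" using Suc.prems by (intro power_strict_mono) auto
  also have "\<dots> = real (card (Pow {..<8 * S}))" by (simp add: card_Pow power_mult)
  finally have "\<not> Pow {..<8 * S} \<subseteq> ?g ` (Pow {..<s} \<times> ?F)"
    using fin by (metis (no_types, lifting) card_mono finite_Pow_iff finite_SigmaI finite_imageI
        finite_lessThan not_le of_nat_less_iff)
  then obtain v where v: "v \<subseteq> {..<8 * S}" "v \<notin> ?g ` (Pow {..<s} \<times> ?F)" by blast
  define M' where "M' = M(s := \<lambda>j. of_bool (j \<in> v))"
  have "\<forall>i<Suc s. l i = 0" if X: "X \<subseteq> {..<8 * S}" "card X \<le> S"
    and l: "\<forall>j\<in>{..<8 * S} - X. (\<Sum>i<Suc s. l i * M' i j) = 0" for X l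
  proof -
    have M'_less: "(\<Sum>i<s. l i * M' i j) = (\<Sum>i<s. l i * M i j)" for j
      by (intro sum.cong) (auto simp: M'_def)
    show ?thesis
    proof (cases "l s = 0")
      case True
      then have "\<forall>j\<in>{..<8 * S} - X. (\<Sum>i<s. l i * M i j) = 0"
        using l by (simp add: M'_less)
      then show ?thesis using M[OF X] True by (auto simp: less_Suc_eq)
    next
      case False
      then have ls: "l s = 1" by simp
      define L where "L = {i. i < s \<and> l i = 1}"
      have sumL: "(\<Sum>i<s. l i * M i j) = (\<Sum>i\<in>L. M i j)" for j
      proof -
        have "(\<Sum>i<s. l i * M i j) = (\<Sum>i\<in>L. l i * M i j)"
          by (rule sum.mono_neutral_right) (auto simp: L_def)
        then show ?thesis by (simp add: L_def)
      qed
      \<comment> \<open>The positions where \<open>v\<close> differs from the sum over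
        \<open>L\<close>. As the combination vanishes off \<open>X\<close>, they all lie in
        \<open>X\<close>, which would put \<open>v\<close> into an excluded ball.\<close>
      define Y where "Y = {j. j < 8 * S \<and> ((\<Sum>i\<in>L. M i j) = 1) \<noteq> (j \<in> v)}"
      have "Y \<subseteq> X"
      proof
        fix j assume "j \<in> Y"
        then have j: "j < 8 * S" "((\<Sum>i\<in>L. M i j) = 1) \<noteq> (j \<in> v)" by (auto simp: Y_def)
        show "j \<in> X"
        proof (rule ccontr)
          assume "j \<notin> X"
          then have "(\<Sum>i\<in>L. M i j) + of_bool (j \<in> v) = 0"
            using l j ls by (auto simp: M'_less sumL M'_def)
          then show False using j(2) by (cases "j \<in> v") auto
        qed
      qed
      moreover have "finite X" using X(1) finite_subset by blast
      ultimately have "card Y \<le> S" using X(2) card_mono[of X Y] by simp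
      moreover have "v = ?g (L, Y)" using v(1) unfolding Y_def split_beta by auto
      moreover have "L \<subseteq> {..<s}" "Y \<subseteq> {..<8 * S}" by (auto simp: L_def Y_def)
      ultimately have "v = ?g (L, Y) \<and> (L, Y) \<in> Pow {..<s} \<times> ?F" by simp
      then have "v \<in> ?g ` (Pow {..<s} \<times> ?F)" by (metis (no_types, lifting) imageI)
      then show ?thesis using v(2) by blast
    qed
  qed
  then show ?case by blast
qed

text \<open>Uniformity of the key given the bits at the positions \<open>X\<close>, in linear form:
  a change of the other bits alone can alter the key by any \<open>y\<close>.\<close>

definition extractor :: "nat \<Rightarrow> (nat \<Rightarrow> nat \<Rightarrow> bit) \<Rightarrow> bool" where
  "extractor S M \<longleftrightarrow> (\<forall>X y. X \<subseteq> {..<8 * S} \<longrightarrow> card X \<le> S \<longrightarrow>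
     (\<exists>z. (\<forall>j\<in>X. z j = 0) \<and> (\<forall>i<S. (\<Sum>j<8 * S. M i j * z j) = y i)))"

text \<open>Distance greater than \<open>S\<close> means that the rows stay independent when at most
  \<open>S\<close> columns are deleted, so the remaining columns already reach every key.\<close>

lemma extractor_exists: "\<exists>M. extractor S M"
proof -
  from gilbert_varshamov[OF order.refl[of S]]
  obtain M :: "nat \<Rightarrow> nat \<Rightarrow> bit" where M: "\<forall>X l. X \<subseteq> {..<8 * S} \<longrightarrow> card X \<le> S \<longrightarrow>
    (\<forall>j\<in>{..<8 * S} - X. (\<Sum>i<S. l i * M i j) = 0) \<longrightarrow> (\<forall>i<S. l i = 0)" ..
  have "\<exists>z. (\<forall>j\<in>X. z j = 0) \<and> (\<forall>i<S. (\<Sum>j<8 * S. M i j * z j) = y i)"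
    if X: "X \<subseteq> {..<8 * S}" "card X \<le> S" for X y
  proof -
    have "\<exists>x. \<forall>i\<in>{..<S}. (\<Sum>j\<in>{..<8 * S} - X. M i j * x j) = y i"
      using M X by (intro independent_rows_surjective) auto
    then obtain x where x: "\<And>i. i < S \<Longrightarrow> (\<Sum>j\<in>{..<8 * S} - X. M i j * x j) = y i" by auto
    have "(\<Sum>j<8 * S. M i j * (if j \<in> X then 0 else x j)) = (\<Sum>j\<in>{..<8 * S} - X. M i j * x j)" for i
      by (intro sum.mono_neutral_cong_right) auto
    then show ?thesis using x by (intro exI[of _ "\<lambda>j. if j \<in> X then 0 else x j"]) auto
  qed
  then show ?thesis unfolding extractor_def by blast
qed

section \<open>Walking around a cycle\<close>

lemma walk_edges_closed:
  assumes "2 \<le> length vs"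
  shows "walk_edges (vs @ [hd vs]) = {{vs ! i, vs ! (Suc i mod length vs)} |i. i < length vs}"
proof -
  have walk: "walk_edges ws = {{ws ! i, ws ! Suc i} |i. Suc i < length ws}" for ws
  proof (induction ws rule: walk_edges.induct)
    case (1 u v p)
    have "{{(u # v # p) ! i, (u # v # p) ! Suc i} |i. Suc i < length (u # v # p)} =
      insert {u, v} {{(v # p) ! i, (v # p) ! Suc i} |i. Suc i < length (v # p)}"
      (is "?L = ?R")
    proof (intro equalityI subsetI)
      fix e assume "e \<in> ?L"
      then obtain i where "e = {(u # v # p) ! i, (u # v # p) ! Suc i}" "Suc i < length (u # v # p)"
        by blast
      then show "e \<in> ?R" by (cases i) auto
    next
      fix e assume "e \<in> ?R"
      then consider "e = {u, v}" |
        i where "e = {(v # p) ! i, (v # p) ! Suc i}" "Suc i < length (v # p)" by blast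
      then show "e \<in> ?L"
      proof cases
        case 1
        then show ?thesis by (intro CollectI exI[of _ 0]) auto
      next
        case 2
        then show ?thesis by (intro CollectI exI[of _ "Suc i"]) auto
      qed
    qed
    then show ?case using 1 by simp
  qed auto
  have hd: "hd vs = vs ! 0" using assms by (intro hd_conv_nth) auto
  have "(vs @ [hd vs]) ! i = vs ! i \<and>(vs @ [hd vs]) ! Suc i = vs ! (Suc i mod length vs)"
    if "i < length vs" for i
    using that assms by (auto simp: nth_append hd mod_Suc)
  then show ?thesis unfolding walk by (intro Collect_cong ex_cong1) auto
qed

text \<open>The cycle is run through periodically by all natural numbers, so that walking along it
  meets no boundary.\<close>

definition cyclic_walk :: "cycle \<Rightarrow> nat \<Rightarrow> (nat \<Rightarrow> nat) \<Rightarrow> bool" where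
  "cyclic_walk C n w \<longleftrightarrow>
     3 \<le> n \<and> (\<forall>i j. w i = w j \<longleftrightarrow> i mod n = j mod n) \<and> C = range (\<lambda>i. {w i, w (Suc i)})"

lemma simple_cycle_cyclic_walk:
  assumes "simple_cycle E C"
  obtains n w where "cyclic_walk C n w"
proof -
  obtain vs where vs: "3 \<le> length vs" "distinct vs" "C = walk_edges (vs @ [hd vs])"
    using assms unfolding simple_cycle_def by blast
  let ?n = "length vs"
  define w where "w i = vs ! (i mod ?n)" for i
  have pos: "i mod ?n < ?n" for i using vs(1) by (intro mod_less_divisor) linarith
  have "w i = w j \<longleftrightarrow> i mod ?n = j mod ?n" for i j
    unfolding w_def using vs(2) pos by (simp add: nth_eq_iff_index_eq)
  moreover have "C = range (\<lambda>i. {w i, w (Suc i)})"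
  proof -
    have "C = (\<lambda>i. {vs ! i, vs ! (Suc i mod ?n)}) ` {..<?n}"
      using vs(1,3) walk_edges_closed[of vs] by auto
    also have "{..<?n} = range (\<lambda>i. i mod ?n)"
      using pos by (auto simp: image_iff) (metis mod_less)
    finally show ?thesis by (simp add: image_image w_def mod_Suc_eq)
  qed
  ultimately show ?thesis using that vs(1) unfolding cyclic_walk_def by blast
qed

text \<open>An edge may have to be traversed in either direction. The index
  \<open>n - i mod n\<close> stays between 1 and \<open>n\<close>, so the subtraction never
  truncates.\<close>

lemma cyclic_walk_reverse:
  assumes "cyclic_walk C n w"
  shows "cyclic_walk C n (\<lambda>i. w (n - i mod n))"
proof -
  have n: "3 \<le> n" and w: "\<And>i j. w i = w j \<longleftrightarrow> i mod n = j mod n"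
    and C: "C = range (\<lambda>i. {w i, w (Suc i)})"
    using assms unfolding cyclic_walk_def by blast+
  have "(n - p) mod n = (n - q) mod n \<longleftrightarrow> p = q" if "p < n" "q < n" for p q
    using that by (cases "p = 0"; cases "q = 0") auto
  then have inj: "w (n - i mod n) = w (n - j mod n) \<longleftrightarrow> i mod n = j mod n" for i j
    using n by (simp add: w)
  have step: "w (n - i mod n) = w (Suc (n - Suc i mod n))" for i
    using n by (auto simp: w mod_Suc Suc_diff_Suc)
  have "range (\<lambda>i. {w (n - i mod n), w (n - Suc i mod n)}) = C"
  proof (intro equalityI subsetI)
    fix e assume "e \<in> range (\<lambda>i. {w (n - i mod n), w (n - Suc i mod n)})"
    then obtain i where "e = {w (n - i mod n), w (n - Suc i mod n)}" by blast
    then have "e = {w (n - Suc i mod n), w (Suc (n - Suc i mod n))}" using step[of i] by auto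
    then show "e \<in> C" unfolding C by blast
  next
    fix e assume "e \<in> C"
    then obtain i where i: "e = {w i, w (Suc i)}" unfolding C by blast
    \<comment> \<open>Step \<open>k\<close> of the reversed walk is step \<open>i\<close> of the
      original one taken backwards.\<close>
    define k where "k = n - Suc (i mod n)"
    have lt: "i mod n < n" using n by (intro mod_less_divisor) linarith
    then have k: "Suc k mod n = (n - i mod n) mod n" by (simp add: k_def Suc_diff_Suc)
    have "n - Suc k mod n = (if i mod n = 0 then n else i mod n)"
      using lt n by (auto simp: k)
    then have "w (n - Suc k mod n) = w i" by (auto simp: w)
    moreover from this have "w (Suc (n - Suc k mod n)) = w (Suc i)"
      unfolding w by (metis mod_Suc_eq)
    then have "w (n - k mod n) = w (Suc i)" using step[of k] by simp
    ultimately have "e = {w (n - k mod n), w (n - Suc k mod n)}" unfolding i by auto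
    then show "e \<in> range (\<lambda>i. {w (n - i mod n), w (n - Suc i mod n)})" by blast
  qed
  then show ?thesis using n inj unfolding cyclic_walk_def by blast
qed

text \<open>Meeting the same edge in opposite directions would make \<open>n\<close> divide 2, which
  \<open>3 \<le> n\<close> excludes.\<close>

lemma cyclic_walk_edge_eq:
  assumes "cyclic_walk C n w"
  shows "{w i, w (Suc i)} = {w j, w (Suc j)} \<longleftrightarrow> i mod n = j mod n"
proof
  have n: "3 \<le> n" and w: "\<And>i j. w i = w j \<longleftrightarrow> i mod n = j mod n"
    using assms unfolding cyclic_walk_def by blast+
  show "{w i, w (Suc i)} = {w j, w (Suc j)}" if "i mod n = j mod n"
    using that w by (metis mod_Suc_eq)
  assume "{w i, w (Suc i)} = {w j, w (Suc j)}"
  then consider "w i = w j" | "w i = w (Suc j)" "w (Suc i) = w j"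
    by (auto simp: doubleton_eq_iff)
  then show "i mod n = j mod n"
  proof cases
    case 2
    then have "i mod n = Suc j mod n" "Suc i mod n = j mod n"
      unfolding w by (simp_all add: mod_Suc_eq)
    then show ?thesis using n by (auto simp: mod_Suc split: if_splits)
  qed (simp add: w)
qed

lemma cyclic_walk_card:
  assumes "cyclic_walk C n w"
  shows "card C = n"
proof -
  have n: "3 \<le> n" and C: "C = range (\<lambda>i. {w i, w (Suc i)})"
    using assms unfolding cyclic_walk_def by blast+
  have "C = (\<lambda>i. {w i, w (Suc i)}) ` {..<n}"
  proof (intro equalityI subsetI)
    fix e assume "e \<in> C"
    then obtain i where "e = {w i, w (Suc i)}" unfolding C by blast
    then have "e = {w (i mod n), w (Suc (i mod n))}"
      using cyclic_walk_edge_eq[OF assms, of i "i mod n"] by simp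
    then show "e \<in> (\<lambda>i. {w i, w (Suc i)}) ` {..<n}" using n by auto
  qed (auto simp: C)
  moreover have "inj_on (\<lambda>i. {w i, w (Suc i)}) {..<n}"
    by (rule inj_onI) (simp add: cyclic_walk_edge_eq[OF assms])
  ultimately show ?thesis by (simp add: card_image)
qed

text \<open>Adding periods moves the position \<open>i\<close> beyond any \<open>m\<close>, which
  leaves room for \<open>m\<close> steps back.\<close>

lemma simple_cycle_walk_through:
  assumes "simple_cycle E C" "{a, b} \<in> C"
  obtains w i where "cyclic_walk C (card C) w" "a = w i" "b = w (Suc i)" "m \<le> i"
proof -
  obtain n w where w: "cyclic_walk C n w"
    using simple_cycle_cyclic_walk[OF assms(1)] .
  have n: "3 \<le> n" and weq: "\<And>i j. w i = w j \<longleftrightarrow> i mod n = j mod n"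
    using w unfolding cyclic_walk_def by blast+
  have shift: "\<exists>j\<ge>m. x = v j \<and> y = v (Suc j)"
    if "cyclic_walk C n v" "x = v i" "y = v (Suc i)" for v x y i
  proof (intro exI conjI)
    have "v i = v j \<longleftrightarrow> i mod n = j mod n" for i j
      using that(1) unfolding cyclic_walk_def by blast
    then show "x = v (i + m * n)" "y = v (Suc (i + m * n))"
      using that(2,3) by (simp_all add: mod_Suc)
    show "m \<le> i + m * n" using n by (simp add: trans_le_add2)
  qed
  obtain i where i: "{a, b} = {w i, w (Suc i)}"
    using w assms(2) unfolding cyclic_walk_def by auto
  then consider "a = w i" "b = w (Suc i)" | "a = w (Suc i)" "b = w i"
    by (auto simp: doubleton_eq_iff)
  then show ?thesis
  proof cases
    case 1
    then show ?thesis using shift[OF w] w that cyclic_walk_card[OF w] by blast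
  next
    case 2
    let ?v = "\<lambda>i. w (n - i mod n)"
    have v: "cyclic_walk C n ?v" by (rule cyclic_walk_reverse[OF w])
    define k where "k = n - Suc (i mod n)"
    have lt: "i mod n < n" using n by (intro mod_less_divisor) linarith
    then have k: "Suc k mod n = (n - i mod n) mod n" "k mod n = n - Suc (i mod n)"
      by (simp_all add: k_def Suc_diff_Suc)
    have "n - Suc k mod n = (if i mod n = 0 then n else i mod n)"
      using lt n by (auto simp: k)
    then have "b = ?v (Suc k)" by (auto simp: weq 2)
    moreover have "n - (n - Suc (i mod n)) = Suc (i mod n)" using lt by linarith
    then have "a = ?v k" by (simp add: k 2 weq mod_Suc_eq)
    ultimately show ?thesis using shift[OF v] v that cyclic_walk_card[OF v] by blast
  qed
qed

section \<open>Neighbours and preceding arcs on a cycle\<close>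

definition across :: "cycle \<Rightarrow> nat \<Rightarrow> nat \<Rightarrow> nat" where
  "across C a b = (THE z. {a, z} \<in> C \<and> z \<noteq> b)"

text \<open>The arc over which a share has come that is about to traverse \<open>p\<close>;
  iterating it leads back to the start of the share.\<close>

definition pred_arc :: "cycle \<Rightarrow> nat \<times> nat \<Rightarrow> nat \<times> nat" where
  "pred_arc C p = (across C (fst p) (snd p), fst p)"

lemma cyclic_walk_across:
  assumes "cyclic_walk C n w"
  shows "across C (w (Suc i)) (w (Suc (Suc i))) = w i"
    and "across C (w (Suc i)) (w i) = w (Suc (Suc i))"
    and "w i \<noteq> w (Suc (Suc i))"
proof -
  have n: "3 \<le> n" and w: "\<And>i j. w i = w j \<longleftrightarrow> i mod n = j mod n"
    and C: "C = range (\<lambda>i. {w i, w (Suc i)})"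
    using assms unfolding cyclic_walk_def by blast+
  show ne: "w i \<noteq> w (Suc (Suc i))"
    using n by (simp add: w mod_Suc)
  have z: "{w (Suc i), z} \<in> C \<longleftrightarrow> z = w i \<or> z = w (Suc (Suc i))" for z
  proof
    assume "{w (Suc i), z} \<in> C"
    then obtain j where "{w (Suc i), z} = {w j, w (Suc j)}" unfolding C by blast
    then consider "w (Suc i) = w j" "z = w (Suc j)" | "w (Suc i) = w (Suc j)" "z = w j"
      by (auto simp: doubleton_eq_iff)
    then show "z = w i \<or> z = w (Suc (Suc i))"
    proof cases
      case 1
      then have "w (Suc (Suc i)) = w (Suc j)" unfolding w by (metis mod_Suc_eq)
      then show ?thesis using 1 by simp
    next
      case 2
      then have "i mod n = j mod n"
        using n unfolding w by (auto simp: mod_Suc split: if_splits)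
      then show ?thesis using 2 w by metis
    qed
  next
    assume "z = w i \<or> z = w (Suc (Suc i))"
    then show "{w (Suc i), z} \<in> C" unfolding C by (auto simp: insert_commute)
  qed
  show "across C (w (Suc i)) (w (Suc (Suc i))) = w i"
    "across C (w (Suc i)) (w i) = w (Suc (Suc i))"
    unfolding across_def z using ne by (auto intro!: the_equality)
qed

lemma cyclic_walk_pred_arc:
  assumes "cyclic_walk C n w"
  shows "(pred_arc C ^^ j) (w (i + j), w (Suc (i + j))) = (w i, w (Suc i))"
proof (induction j)
  case (Suc j)
  have "pred_arc C (w (Suc (i + j)), w (Suc (Suc (i + j)))) = (w (i + j), w (Suc (i + j)))"
    using cyclic_walk_across(1)[OF assms, of "i + j"] by (simp add: pred_arc_def)
  then show ?case using Suc by (simp add: funpow_Suc_right del: funpow.simps)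
qed simp

context
  fixes E C a b
  assumes cycle: "simple_cycle E C" and ab: "{a, b} \<in> C"
begin

lemma card_simple_cycle: "3 \<le> card C"
proof -
  obtain w i where "cyclic_walk C (card C) w" "a = w i" "b = w (Suc i)" "0 \<le> i"
    using simple_cycle_walk_through[OF cycle ab] .
  then show ?thesis unfolding cyclic_walk_def by blast
qed

lemma across_in_cycle:
  "{a, across C a b} \<in> C" "across C a b \<noteq> b" "across C a (across C a b) = b"
proof -
  obtain w i where w: "cyclic_walk C (card C) w" "a = w i" "b = w (Suc i)" "1 \<le> i"
    using simple_cycle_walk_through[OF cycle ab] .
  then obtain k where "i = Suc k" by (cases i) auto
  with w cyclic_walk_across[OF w(1), of k] show
    "{a, across C a b} \<in> C" "across C a b \<noteq> b" "across C a (across C a b) = b"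
    unfolding cyclic_walk_def by (auto simp: insert_commute)
qed

text \<open>Positions that differ by less than the period carry different edges; hence a share sent
  around a cycle never crosses the edge that it is to bypass.\<close>

lemma pred_arc_iterate_in_cycle:
  assumes "(pred_arc C ^^ j) (a, b) = (x, y)"
  shows "{x, y} \<in> C" "0 < j \<Longrightarrow> j < card C \<Longrightarrow> {x, y} \<noteq> {a, b}"
proof -
  obtain w i where w: "cyclic_walk C (card C) w" "a = w i" "b = w (Suc i)" "j \<le> i"
    using simple_cycle_walk_through[OF cycle ab] .
  then obtain k where k: "i = k + j" by (metis add.commute le_Suc_ex)
  then have xy: "x = w k" "y = w (Suc k)"
    using w assms cyclic_walk_pred_arc[OF w(1), of j k] by simp_all
  then show "{x, y} \<in> C" using w(1) unfolding cyclic_walk_def by auto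
  assume j: "0 < j" "j < card C"
  show "{x, y} \<noteq> {a, b}"
  proof
    assume "{x, y} = {a, b}"
    then have "{w k, w (Suc k)} = {w (k + j), w (Suc (k + j))}"
      using xy w k by simp
    then have "k mod card C = (k + j) mod card C"
      using cyclic_walk_edge_eq[OF w(1), of k "k + j"] by blast
    then have "card C dvd j" by (metis add_diff_cancel_left' mod_eq_dvd_iff_nat le_add1)
    then show False using j by (simp add: nat_dvd_not_less)
  qed
qed

text \<open>On a closed walk, \<open>card C - 1\<close> steps back amount to one step forward. This
  lets the receiver's end be linked to the first hop at the sender.\<close>

lemma pred_arc_round_trip: "(pred_arc C ^^ (card C - 1)) (a, b) = (b, across C b a)"
proof -
  obtain w i where w: "cyclic_walk C (card C) w" "a = w i" "b = w (Suc i)" "card C \<le> i"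
    using simple_cycle_walk_through[OF cycle ab] .
  define k where "k = i - (card C - 1)"
  have k: "i = k + (card C - 1)" using w(4) by (simp add: k_def)
  have n: "card C \<noteq> 0" using card_simple_cycle by simp
  have weq: "w (x + card C) = w x" for x
    using w(1) unfolding cyclic_walk_def by simp
  have "(pred_arc C ^^ (card C - 1)) (a, b) = (w k, w (Suc k))"
    using cyclic_walk_pred_arc[OF w(1), of "card C - 1" k] w k by simp
  moreover have "b = w k" using n w(3) weq[of k] by (simp add: k)
  moreover have "across C b a = w (Suc k)"
    using cyclic_walk_across(2)[OF w(1), of i] w(2,3) weq[of "Suc k"] n by (simp add: k)
  ultimately show ?thesis by simp
qed

end

section \<open>Coins, executions and views\<close>

definition coin_space :: "nat set \<Rightarrow> nat \<Rightarrow> (nat \<Rightarrow> bool list) set" where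
  "coin_space V l = PiE_dflt V [] (\<lambda>_. {bs. length bs = l})"

lemma finite_bool_lists: "finite {bs :: bool list. length bs = l}"
  using finite_lists_length_eq[of "UNIV :: bool set" l] by simp

lemma bool_lists_nonempty: "{bs :: bool list. length bs = l} \<noteq> {}"
  using length_replicate[of l True] by blast

lemma finite_coin_space: "finite V \<Longrightarrow> finite (coin_space V l)"
  unfolding coin_space_def by (rule finite_PiE_dflt) (simp_all add: finite_bool_lists)

lemma coin_space_nonempty: "coin_space V l \<noteq> {}"
proof -
  have "(\<lambda>v. if v \<in> V then replicate l True else []) \<in> coin_space V l"
    by (auto simp: coin_space_def PiE_dflt_def)
  then show ?thesis by blast
qed

lemma coins_eq_pmf_of_set: "finite V \<Longrightarrow> coins V l = pmf_of_set (coin_space V l)"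
  unfolding coins_def coin_space_def
  by (rule Pi_pmf_of_set) (simp_all only: finite_bool_lists bool_lists_nonempty not_False_eq_True)

lemma set_pmf_coins: "finite V \<Longrightarrow> set_pmf (coins V l) = coin_space V l"
  by (simp add: coins_eq_pmf_of_set finite_coin_space coin_space_nonempty)

lemma pair_pmf_of_set:
  assumes "finite X" "X \<noteq> {}" "finite Y" "Y \<noteq> {}"
  shows "pair_pmf (pmf_of_set X) (pmf_of_set Y) = pmf_of_set (X \<times> Y)"
proof (rule pmf_eqI)
  fix p
  show "pmf (pair_pmf (pmf_of_set X) (pmf_of_set Y)) p = pmf (pmf_of_set (X \<times> Y)) p"
    using assms by (cases p) (simp add: pmf_pair card_cartesian_product indicator_def)
qed

text \<open>Separates the coins of \<open>A\<close> from the additional ones, so that the former can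
  be fixed while the latter stay uniform.\<close>

lemma coins_append:
  assumes "finite V"
  shows "coins V (k + l) = map_pmf (\<lambda>(a, b) v. a v @ b v) (pair_pmf (coins V k) (coins V l))"
proof -
  let ?f = "\<lambda>(a, b) v. a v @ b v" and ?X = "coin_space V k \<times> coin_space V l"
  have "bij_betw ?f ?X (coin_space V (k + l))"
    unfolding bij_betw_def
  proof
    show "inj_on ?f ?X"
    proof (rule inj_onI, clarify)
      fix a b a' b'
      assume mem: "a \<in> coin_space V k" "b \<in> coin_space V l" "a' \<in> coin_space V k" "b' \<in> coin_space V l"
        and eq: "(\<lambda>v. a v @ b v) = (\<lambda>v. a' v @ b' v)"
      have "a v = a' v \<and> b v = b' v" for v
        using fun_cong[OF eq, of v] mem
        by (cases "v \<in> V") (auto simp: coin_space_def PiE_dflt_def)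
      then show "a = a' \<and> b = b'" by blast
    qed
    show "?f ` ?X = coin_space V (k + l)"
    proof (intro equalityI subsetI)
      fix w assume w: "w \<in> coin_space V (k + l)"
      have "w = ?f (\<lambda>v. take k (w v), \<lambda>v. drop k (w v))" by simp
      moreover have "(\<lambda>v. take k (w v), \<lambda>v. drop k (w v)) \<in> ?X"
        using w by (auto simp: coin_space_def PiE_dflt_def)
      ultimately show "w \<in> ?f ` ?X" by (rule image_eqI)
    qed (auto simp: coin_space_def PiE_dflt_def)
  qed
  then have "map_pmf ?f (pmf_of_set ?X) = pmf_of_set (coin_space V (k + l))"
    using finite_coin_space[OF assms] coin_space_nonempty
    by (intro map_pmf_of_set_bij_betw) auto
  then show ?thesis
    using finite_coin_space[OF assms] coin_space_nonempty
    by (simp add: coins_eq_pmf_of_set[OF assms] pair_pmf_of_set)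
qed

lemma coins_of_append:
  assumes "a \<in> coin_space V (coin_bits A)" "b \<in> coin_space V l"
  shows "coins_of A (\<lambda>v. a v @ b v) = a"
proof
  show "coins_of A (\<lambda>v. a v @ b v) v = a v" for v
    using assms by (cases "v \<in> V") (auto simp: coins_of_def coin_space_def PiE_dflt_def)
qed

text \<open>The common conditional law \<open>D\<close> is also the marginal law, so the joint law
  is a product. This reduces secrecy to fixed inputs and fixed coins of \<open>A\<close>.\<close>

lemma independent_if_conditionals_equal:
  assumes "\<And>s. s \<in> set_pmf P \<Longrightarrow> map_pmf (g s) Q = D"
  shows "map_pmf (\<lambda>(s, r). (f s, g s r)) (pair_pmf P Q) =
    pair_pmf (map_pmf f P) (map_pmf (\<lambda>(s, r). g s r) (pair_pmf P Q))"
proof -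
  have "map_pmf (\<lambda>(s, r). g s r) (pair_pmf P Q) = bind_pmf P (\<lambda>s. map_pmf (g s) Q)"
    by (simp add: pair_pmf_def map_pmf_def bind_assoc_pmf bind_return_pmf)
  also have "\<dots> = bind_pmf P (\<lambda>_. D)"
    by (intro bind_pmf_cong refl assms)
  finally have D: "map_pmf (\<lambda>(s, r). g s r) (pair_pmf P Q) = D" by simp
  have "map_pmf (\<lambda>(s, r). (f s, g s r)) (pair_pmf P Q) =
    bind_pmf P (\<lambda>s. map_pmf (Pair (f s)) (map_pmf (g s) Q))"
    by (simp add: pair_pmf_def map_pmf_def bind_assoc_pmf bind_return_pmf)
  also have "\<dots> = bind_pmf P (\<lambda>s. map_pmf (Pair (f s)) D)"
    by (intro bind_pmf_cong refl) (simp add: assms)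
  also have "\<dots> = pair_pmf (map_pmf f P) D"
    by (simp add: pair_pmf_def map_pmf_def bind_assoc_pmf bind_return_pmf)
  finally show ?thesis unfolding D .
qed

section \<open>Executions and views determined round by round\<close>

lemma histories_eq_map_messages:
  "histories A E x \<omega> t v = map (\<lambda>s u. messages A E x \<omega> s u v) [0..<t]"
  by (induction t) (simp_all add: messages_def)

lemma histories_take:
  "t \<le> s \<Longrightarrow> take t (histories A E x \<omega> s v) = histories A E x \<omega> t v"
  by (simp add: histories_eq_map_messages take_map)

lemma length_histories [simp]: "length (histories A E x \<omega> t v) = t"
  by (simp add: histories_eq_map_messages)

text \<open>An execution is determined round by round, so messages that reproduce themselves when
  fed to the nodes as their history are the actual ones.\<close>

lemma messages_eqI:
  assumes "\<And>t u v. sent A E x \<omega> (\<lambda>v. map (\<lambda>s u. G s u v) [0..<t]) u v = G t u v"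
  shows "messages A E x \<omega> = G"
proof -
  have "histories A E x \<omega> t = (\<lambda>v. map (\<lambda>s u. G s u v) [0..<t])" for t
    by (induction t) (simp_all add: assms)
  then have "histories A E x \<omega> = (\<lambda>t v. map (\<lambda>s u. G s u v) [0..<t])" by (rule ext)
  then show ?thesis by (intro ext) (simp add: messages_def assms)
qed

text \<open>The next choice of edges depends on the view only, so agreement on the edges chosen in
  one run makes the other run choose the same edges.\<close>

lemma view_cong:
  assumes "\<And>t. t < T \<Longrightarrow> observe (\<sigma> (view \<sigma> m t)) (m' t) = observe (\<sigma> (view \<sigma> m t)) (m t)"
  shows "view \<sigma> m' T = view \<sigma> m T"
  using assms
proof (induction T)
  case (Suc T)
  then have "view \<sigma> m' T = view \<sigma> m T" by simp
  then show ?case using Suc.prems[of T] by simp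
qed simp

lemma bit_add_self [simp]: "x + x = (0 :: bit)"
  by (cases x) simp_all

lemma bit_add_self_left [simp]: "x + (x + y) = (y :: bit)"
  by (simp add: add.assoc[symmetric])

lemma of_bool_eq_one_bit [simp]: "of_bool (x = 1) = (x :: bit)"
  by (cases x) simp_all

section \<open>The compiled algorithm\<close>

definition edge_cycles :: "cycle set \<Rightarrow> nat \<Rightarrow> nat \<Rightarrow> cycle set" where
  "edge_cycles \<C> a b = {C \<in> \<C>. {a, b} \<in> C}"

text \<open>The choice depends on the set alone, so both ends of an edge number the cycles through
  it alike without communicating.\<close>

definition cycle_index :: "cycle set \<Rightarrow> cycle \<Rightarrow> nat" where
  "cycle_index X = (SOME f. bij_betw f X {..<card X})"

definition cycle_at :: "cycle set \<Rightarrow> nat \<Rightarrow> cycle" where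
  "cycle_at X = inv_into X (cycle_index X)"

lemma cycle_index_bij: "finite X \<Longrightarrow> bij_betw (cycle_index X) X {..<card X}"
  unfolding cycle_index_def
  using someI_ex[OF ex_bij_betw_finite_nat[of X]] by (simp add: atLeast0LessThan)

lemma cycle_index_less: "finite X \<Longrightarrow> C \<in> X \<Longrightarrow> cycle_index X C < card X"
  using bij_betwE[OF cycle_index_bij[of X]] by auto

lemma cycle_at_index: "finite X \<Longrightarrow> C \<in> X \<Longrightarrow> cycle_at X (cycle_index X C) = C"
  unfolding cycle_at_def by (rule bij_betw_inv_into_left[OF cycle_index_bij])

lemma cycle_index_at: "finite X \<Longrightarrow> i < card X \<Longrightarrow> cycle_index X (cycle_at X i) = i"
  unfolding cycle_at_def using bij_betw_inv_into_right[OF cycle_index_bij[of X], of i] by simp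

lemma cycle_at_in: "finite X \<Longrightarrow> i < card X \<Longrightarrow> cycle_at X i \<in> X"
  unfolding cycle_at_def using bij_betwE[OF bij_betw_inv_into[OF cycle_index_bij[of X]]] by auto

lemma edge_cycles_commute: "edge_cycles \<C> a b = edge_cycles \<C> b a"
  by (simp add: edge_cycles_def insert_commute)

text \<open>A message shorter than \<open>B\<close> is padded to \<open>B\<close> bits by a single \<open>True\<close> followed by \<open>False\<close>s.\<close>

definition encode_bit :: "msg \<Rightarrow> nat \<Rightarrow> bool" where
  "encode_bit m b = (if b < length m then m ! b else b = length m)"

definition decode :: "msg \<Rightarrow> msg" where
  "decode bs = rev (tl (dropWhile Not (rev bs)))"

lemma decode_encode:
  assumes "length m < B"
  shows "decode (map (encode_bit m) [0..<B]) = m"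
proof -
  have "map (encode_bit m) [0..<B] = m @ True # replicate (B - Suc (length m)) False"
  proof (rule nth_equalityI)
    fix i assume "i < length (map (encode_bit m) [0..<B])"
    then show "map (encode_bit m) [0..<B] ! i =
        (m @ True # replicate (B - Suc (length m)) False) ! i"
      by (cases "i - length m") (auto simp: encode_bit_def nth_append)
  qed (use assms in simp)
  moreover have "dropWhile Not (replicate j False @ xs) = dropWhile Not xs" for j xs
    by (induction j) simp_all
  ultimately show ?thesis by (simp add: decode_def)
qed

locale compiler =
  fixes A :: "('i, 'o) algorithm" and R B N d c :: nat
begin

definition num_slots :: nat where
  "num_slots = R * B * (d * c + 1)"

definition key_rounds :: nat where
  "key_rounds = 8 * num_slots"

definition total_rounds :: nat where
  "total_rounds = key_rounds + num_slots"

text \<open>A fixed choice that depends on \<open>num_slots\<close> only, hence the same code at all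
  nodes.\<close>

definition M :: "nat \<Rightarrow> nat \<Rightarrow> bit" where
  "M = (SOME M. extractor num_slots M)"

definition key :: "(nat \<Rightarrow> bit) \<Rightarrow> nat \<Rightarrow> bit" where
  "key f q = (\<Sum>j<key_rounds. M q j * f j)"

text \<open>Slot \<open>slot t b (j * c + i)\<close> carries hop \<open>j\<close> along the \<open>i\<close>-th cycle through an edge,
  for the shares of bit \<open>b\<close> of the messages of round \<open>t\<close>; in \<open>slot t b (d * c)\<close> the remaining share
  travels over the edge itself.\<close>

definition slot :: "nat \<Rightarrow> nat \<Rightarrow> nat \<Rightarrow> nat" where
  "slot t b s = (t * B + b) * (d * c + 1) + s"

definition hop_slot :: "cycle set \<Rightarrow> nat \<Rightarrow> nat \<Rightarrow> nat \<Rightarrow> cycle \<Rightarrow> nat \<times> nat \<Rightarrow> nat" where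
  "hop_slot \<C> t b j C p = slot t b (j * c + cycle_index (edge_cycles \<C> (fst p) (snd p)) C)"

text \<open>The additional coins follow those of \<open>A\<close> in blocks of
  \<open>key_rounds\<close> bits, one block for each possible ID \<open>z\<close> of a
  neighbour.\<close>

definition own_bit :: "bool list \<Rightarrow> nat \<Rightarrow> nat \<Rightarrow> bit" where
  "own_bit \<omega> z j = of_bool (\<omega> ! (coin_bits A + (z * key_rounds + j)))"

definition received :: "history \<Rightarrow> nat \<Rightarrow> nat \<Rightarrow> bit" where
  "received h z j = of_bool (hd ((h ! j) z))"

definition decrypted :: "history \<Rightarrow> nat \<Rightarrow> nat \<Rightarrow> bit" where
  "decrypted h z q = received h z (key_rounds + q) + key (received h z) q"

text \<open>A share bypasses the edge between \<open>v\<close> and \<open>z\<close> over the other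
  \<open>card C - 1\<close> edges, in hops 0 to \<open>card C - 2\<close>, and reaches
  \<open>v\<close> from its other neighbour on the cycle.\<close>

definition received_bit :: "nat \<Rightarrow> cycle set \<Rightarrow> history \<Rightarrow> nat \<Rightarrow> nat \<Rightarrow> nat \<Rightarrow> bit" where
  "received_bit v \<C> h t b z = decrypted h z (slot t b (d * c)) +
     (\<Sum>C\<in>edge_cycles \<C> v z.
        decrypted h (across C v z) (hop_slot \<C> t b (card C - 2) C (across C v z, v)))"

definition simulated :: "nat \<Rightarrow> nat set \<Rightarrow> cycle set \<Rightarrow> history \<Rightarrow> nat \<Rightarrow> history" where
  "simulated v Nb \<C> h t =
     map (\<lambda>s z. if z \<in> Nb then decode (map (\<lambda>b. received_bit v \<C> h s b z = 1) [0..<B]) else [])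
       [0..<t]"

definition relayed_bit ::
  "nat \<Rightarrow> cycle set \<Rightarrow> bool list \<Rightarrow> history \<Rightarrow> nat \<Rightarrow> nat \<Rightarrow> nat \<Rightarrow> nat \<Rightarrow> bit" where
  "relayed_bit v \<C> \<omega> h t b s z =
     (let j = s div c; X = edge_cycles \<C> v z; C = cycle_at X (s mod c); y = across C v z in
      if s mod c < card X \<and> 0 < j \<and> j < card C - 1
      then decrypted h y (hop_slot \<C> t b (j - 1) C (y, v)) + key (own_bit \<omega> z) (slot t b s)
      else 0)"

definition direct_bit ::
  "nat \<Rightarrow> nat set \<Rightarrow> cycle set \<Rightarrow> 'i \<Rightarrow> bool list \<Rightarrow> history \<Rightarrow> nat \<Rightarrow> nat \<Rightarrow> nat \<Rightarrow> bit" where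
  "direct_bit v Nb \<C> x \<omega> h t b z =
     (let H = simulated v Nb \<C> h t; a = take (coin_bits A) \<omega>;
          m = (if halted A v Nb x a H then [] else send A v Nb x a H z)
      in of_bool (encode_bit m b) +
         (\<Sum>C\<in>edge_cycles \<C> v z.
            key (own_bit \<omega> (across C v z)) (hop_slot \<C> t b 0 C (v, across C v z))) +
         key (own_bit \<omega> z) (slot t b (d * c)))"

definition compiled_bit ::
  "nat \<Rightarrow> nat set \<Rightarrow> cycle set \<Rightarrow> 'i \<Rightarrow> bool list \<Rightarrow> history \<Rightarrow> nat \<Rightarrow> bit" where
  "compiled_bit v Nb \<C> x \<omega> h z =
     (if length h < key_rounds then own_bit \<omega> z (length h)
      else let q = length h - key_rounds; s = q mod (d * c + 1);
               t = q div (d * c + 1) div B; b = q div (d * c + 1) mod B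
           in if s < d * c then relayed_bit v \<C> \<omega> h t b s z
              else direct_bit v Nb \<C> x \<omega> h t b z)"

text \<open>Every node runs until \<open>total_rounds\<close>, so the moments at which nodes of
  \<open>A\<close> halt leave no trace in the traffic.\<close>

definition compiled_out ::
  "nat \<Rightarrow> nat set \<Rightarrow> cycle set \<Rightarrow> 'i \<Rightarrow> bool list \<Rightarrow> history \<Rightarrow> 'o option" where
  "compiled_out v Nb \<C> x \<omega> h =
     (if length h < total_rounds then None
      else let H = simulated v Nb \<C> h R; o' = (\<lambda>t. out A v Nb x (take (coin_bits A) \<omega>) (take t H))
           in o' (LEAST t. o' t \<noteq> None))"

definition compiled_algorithm :: "(cycle set \<times> 'i, 'o) algorithm" where
  "compiled_algorithm =
     \<lparr>coin_bits = coin_bits A + N * key_rounds,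
      send = (\<lambda>v Nb x \<omega> h z. [compiled_bit v Nb (fst x) (snd x) \<omega> h z = 1]),
      out = (\<lambda>v Nb x \<omega> h. compiled_out v Nb (fst x) (snd x) \<omega> h)\<rparr>"

definition arc_key :: "(nat \<Rightarrow> nat \<Rightarrow> nat \<Rightarrow> bit) \<Rightarrow> nat \<times> nat \<Rightarrow> nat \<Rightarrow> bit" where
  "arc_key r p = key (r (fst p) (snd p))"

text \<open>The share that travels around a cycle is the key of its first hop, so that no randomness besides
  the keys is needed; hop \<open>0\<close> then has nothing to carry.\<close>

definition slot_bit :: "cycle set \<Rightarrow> (nat \<Rightarrow> nat \<Rightarrow> nat \<Rightarrow> msg) \<Rightarrow>
    (nat \<Rightarrow> nat \<Rightarrow> nat \<Rightarrow> bit) \<Rightarrow> nat \<Rightarrow> nat \<Rightarrow> nat \<Rightarrow> nat \<Rightarrow> nat \<Rightarrow> bit" where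
  "slot_bit \<C> m r t b s u v =
     (if s < d * c
      then let j = s div c; X = edge_cycles \<C> u v; C = cycle_at X (s mod c);
               p = (pred_arc C ^^ j) (u, v)
           in if s mod c < card X \<and> j < card C - 1
              then arc_key r p (hop_slot \<C> t b 0 C p) + arc_key r (u, v) (slot t b s) else 0
      else of_bool (encode_bit (m t u v) b) +
           (\<Sum>C\<in>edge_cycles \<C> u v.
              arc_key r (u, across C u v) (hop_slot \<C> t b 0 C (u, across C u v))) +
           arc_key r (u, v) (slot t b s))"

text \<open>The whole traffic in closed form, from the messages \<open>m\<close> of \<open>A\<close>
  and the random bits \<open>r\<close>. Executions are shown to produce it, and secrecy is then a
  statement about this function.\<close>

definition transcript :: "edge set \<Rightarrow> cycle set \<Rightarrow> (nat \<Rightarrow> nat \<Rightarrow> nat \<Rightarrow> msg) \<Rightarrow>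
    (nat \<Rightarrow> nat \<Rightarrow> nat \<Rightarrow> bit) \<Rightarrow> nat \<Rightarrow> nat \<Rightarrow> nat \<Rightarrow> msg" where
  "transcript E \<C> m r \<tau> u v =
     (if {u, v} \<in> E \<and> \<tau> < total_rounds
      then [(if \<tau> < key_rounds then r u v \<tau>
             else let q = \<tau> - key_rounds
                  in slot_bit \<C> m r (q div (d * c + 1) div B) (q div (d * c + 1) mod B)
                       (q mod (d * c + 1)) u v) = 1]
      else [])"

section \<open>Arithmetic of slots\<close>

lemma slot_less:
  assumes "t < R" "b < B" "s \<le> d * c"
  shows "slot t b s < num_slots"
proof -
  have "t * B + b < R * B"
    using assms(1,2) mult_le_mono1[of "Suc t" R B] by simp
  then have "(t * B + b + 1) * (d * c + 1) \<le> R * B * (d * c + 1)" by (intro mult_le_mono1) simp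
  then show ?thesis using assms(3) by (simp add: slot_def num_slots_def)
qed

text \<open>Causality: all slots serving earlier rounds of \<open>A\<close> are over before a
  message of round \<open>t\<close> has to be known.\<close>

lemma slot_less_slot:
  assumes "t' < t" "b' < B" "s' \<le> d * c"
  shows "slot t' b' s' < slot t b s"
proof -
  have "t' * B + b' < t * B + b"
    using assms(1,2) mult_le_mono1[of "Suc t'" t B] by simp
  then have "(t' * B + b' + 1) * (d * c + 1) \<le> (t * B + b) * (d * c + 1)" by (intro mult_le_mono1) simp
  then show ?thesis using assms(3) by (simp add: slot_def)
qed

lemma slot_div_mod:
  assumes "b < B" "s \<le> d * c"
  shows "slot t b s div (d * c + 1) div B = t" "slot t b s div (d * c + 1) mod B = b"
    "slot t b s mod (d * c + 1) = s"
proof -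
  have "slot t b s div (d * c + 1) = t * B + b"
    unfolding slot_def by (rule div_nat_eqI) (use assms(2) in \<open>simp_all add: algebra_simps\<close>)
  then show "slot t b s div (d * c + 1) div B = t" "slot t b s div (d * c + 1) mod B = b"
    using assms(1) by simp_all
  show "slot t b s mod (d * c + 1) = s"
    unfolding slot_def using assms(2) by (subst mod_mult_self3) simp
qed

lemma slot_cases:
  assumes "q < num_slots"
  obtains t b s where "t < R" "b < B" "s \<le> d * c" "q = slot t b s"
proof
  let ?t = "q div (d * c + 1) div B" and ?b = "q div (d * c + 1) mod B" and ?s = "q mod (d * c + 1)"
  have q: "q div (d * c + 1) < R * B"
    using assms unfolding num_slots_def by (rule less_mult_imp_div_less)
  then show "?t < R" by (rule less_mult_imp_div_less)
  show "?b < B" using q by (cases "B = 0") simp_all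
  have "?s < d * c + 1" by (rule mod_less_divisor) simp
  then show "?s \<le> d * c" by simp
  show "q = slot ?t ?b ?s" unfolding slot_def by (simp only: div_mult_mod_eq)
qed

lemma hop_less:
  assumes "j < d" "i < c"
  shows "j * c + i < d * c"
  using assms mult_le_mono1[of "Suc j" d c] by simp

lemma extractor_M: "extractor num_slots M"
  unfolding M_def by (rule someI_ex[OF extractor_exists])

lemma compiled_algorithm_simps [simp]:
  "coin_bits compiled_algorithm = coin_bits A + N * key_rounds"
  "send compiled_algorithm v Nb x \<omega> h z = [compiled_bit v Nb (fst x) (snd x) \<omega> h z = 1]"
  "out compiled_algorithm v Nb x \<omega> h = compiled_out v Nb (fst x) (snd x) \<omega> h"
  by (simp_all add: compiled_algorithm_def)

end

section \<open>Traffic on a graph with a cycle cover\<close>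

locale covered_graph = compiler A R B N d c
  for A :: "('i, 'o) algorithm" and R B N d c :: nat +
  fixes V :: "nat set" and E :: "edge set" and \<C> :: "cycle set"
  assumes graph: "simple_graph V E"
    and simple_cycles: "C \<in> \<C> \<Longrightarrow> simple_cycle E C"
    and congestion: "e \<in> E \<Longrightarrow> card {C \<in> \<C>. e \<in> C} \<le> c"
    and cycle_length: "C \<in> \<C> \<Longrightarrow> card C \<le> d"
begin

lemma finite_V: "finite V"
  using graph by (simp add: simple_graph_def)

lemma edge_in_V: "{u, v} \<in> E \<Longrightarrow> u \<in> V \<and> v \<in> V"
  using graph unfolding simple_graph_def by (auto simp: doubleton_eq_iff)

lemma finite_E: "finite E"
proof (rule finite_subset)
  show "E \<subseteq> Pow V" using graph unfolding simple_graph_def by auto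
qed (simp add: finite_V)

lemma finite_cover: "finite \<C>"
proof (rule finite_subset)
  show "\<C> \<subseteq> Pow E" using simple_cycles unfolding simple_cycle_def by blast
qed (simp add: finite_E)

lemma finite_edge_cycles [simp]: "finite (edge_cycles \<C> a b)"
  unfolding edge_cycles_def using finite_cover by simp

lemma edge_cyclesD:
  assumes "C \<in> edge_cycles \<C> a b"
  shows "C \<in> \<C>" "simple_cycle E C" "{a, b} \<in> C" "{a, b} \<in> E" "3 \<le> card C" "card C \<le> d"
proof -
  show C: "C \<in> \<C>" "{a, b} \<in> C" using assms by (simp_all add: edge_cycles_def)
  show s: "simple_cycle E C" by (rule simple_cycles[OF C(1)])
  then show "{a, b} \<in> E" using C(2) unfolding simple_cycle_def by blast
  show "3 \<le> card C" by (rule card_simple_cycle[OF s C(2)])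
  show "card C \<le> d" by (rule cycle_length[OF C(1)])
qed

lemma index_less_c:
  assumes "C \<in> edge_cycles \<C> a b"
  shows "cycle_index (edge_cycles \<C> a b) C < c"
proof -
  have "cycle_index (edge_cycles \<C> a b) C < card (edge_cycles \<C> a b)"
    using assms by (intro cycle_index_less) simp_all
  also have "\<dots> \<le> c"
    using congestion[OF edge_cyclesD(4)[OF assms]] by (simp add: edge_cycles_def)
  finally show ?thesis .
qed

lemma pred_arc_in:
  assumes "C \<in> edge_cycles \<C> u v" "(pred_arc C ^^ j) (u, v) = p"
  shows "C \<in> edge_cycles \<C> (fst p) (snd p)"
  using pred_arc_iterate_in_cycle(1)[OF edge_cyclesD(2,3)[OF assms(1)], of j "fst p" "snd p"]
    assms edge_cyclesD(1)[OF assms(1)]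
  by (simp add: edge_cycles_def)

lemma across_in:
  assumes "C \<in> edge_cycles \<C> u v"
  shows "C \<in> edge_cycles \<C> u (across C u v)" "across C u (across C u v) = v"
  using across_in_cycle[OF edge_cyclesD(2,3)[OF assms]] edge_cyclesD(1)[OF assms]
  by (simp_all add: edge_cycles_def)

lemma hop_slot_eq:
  assumes "C \<in> edge_cycles \<C> (fst p) (snd p)" "j < card C - 1"
  obtains s where "hop_slot \<C> t b j C p = slot t b s" "s < d * c" "s div c = j"
    "s mod c = cycle_index (edge_cycles \<C> (fst p) (snd p)) C" "s < Suc j * c"
proof
  let ?i = "cycle_index (edge_cycles \<C> (fst p) (snd p)) C"
  have i: "?i < c" by (rule index_less_c[OF assms(1)])
  show "hop_slot \<C> t b j C p = slot t b (j * c + ?i)" by (simp add: hop_slot_def)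
  show "j * c + ?i < d * c" using assms(2) edge_cyclesD(6)[OF assms(1)] i by (intro hop_less) auto
  show "(j * c + ?i) div c = j" "(j * c + ?i) mod c = ?i" "j * c + ?i < Suc j * c" using i by auto
qed

text \<open>The share that crosses \<open>(u, v)\<close> in hop \<open>j\<close> set out
  \<open>j\<close> arcs earlier, on \<open>p\<close>, and equals the key of that first hop.\<close>

lemma slot_bit_hop:
  assumes "C \<in> edge_cycles \<C> u v" "j < card C - 1" "hop_slot \<C> t b j C (u, v) = slot t b s"
    "s \<le> d * c" "b < B"
  shows "slot_bit \<C> m r t b s u v =
    (let p = (pred_arc C ^^ j) (u, v)
     in arc_key r p (hop_slot \<C> t b 0 C p) + arc_key r (u, v) (slot t b s))"
proof -
  obtain s' where s': "hop_slot \<C> t b j C (u, v) = slot t b s'" "s' < d * c" "s' div c = j"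
    "s' mod c = cycle_index (edge_cycles \<C> u v) C"
    using hop_slot_eq[of C "(u, v)" j t b] assms(1,2) by auto
  then have "s = s'" using assms(3) by (simp add: slot_def)
  then show ?thesis
    using s' assms(1,2) cycle_at_index[of "edge_cycles \<C> u v" C]
      cycle_index_less[of "edge_cycles \<C> u v" C]
    by (simp add: slot_bit_def Let_def)
qed

end

section \<open>Correctness\<close>

context covered_graph
begin

context
  fixes m :: "nat \<Rightarrow> nat \<Rightarrow> nat \<Rightarrow> msg" and r :: "nat \<Rightarrow> nat \<Rightarrow> nat \<Rightarrow> bit" and v T :: nat and h :: history
  assumes h: "h = map (\<lambda>\<tau> u. transcript E \<C> m r \<tau> u v) [0..<T]"
    and T: "key_rounds \<le> T" "T \<le> total_rounds"
begin

lemma key_received: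
  assumes "{u, v} \<in> E"
  shows "key (received h u) q = arc_key r (u, v) q"
  unfolding key_def arc_key_def using T assms
  by (intro sum.cong refl) (simp add: received_def h transcript_def)

lemma received_slot:
  assumes "{u, v} \<in> E" "b < B" "s \<le> d * c" "key_rounds + slot t b s < T"
  shows "received h u (key_rounds + slot t b s) = slot_bit \<C> m r t b s u v"
  using T assms slot_div_mod[OF assms(2,3), of t]
  by (simp add: received_def h transcript_def del: of_bool_eq)

lemma decrypted_hop:
  assumes "C \<in> edge_cycles \<C> u v" "j < card C - 1" "b < B"
    and "key_rounds + hop_slot \<C> t b j C (u, v) < T" "(pred_arc C ^^ j) (u, v) = p"
  shows "decrypted h u (hop_slot \<C> t b j C (u, v)) = arc_key r p (hop_slot \<C> t b 0 C p)"
proof -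
  obtain s where s: "hop_slot \<C> t b j C (u, v) = slot t b s" "s < d * c"
    using hop_slot_eq[of C "(u, v)" j t b] assms(1,2) by auto
  have "received h u (key_rounds + slot t b s) = slot_bit \<C> m r t b s u v"
    using s assms by (intro received_slot edge_cyclesD(4)[OF assms(1)]) auto
  also have "\<dots> = arc_key r p (hop_slot \<C> t b 0 C p) + arc_key r (u, v) (slot t b s)"
    using slot_bit_hop[OF assms(1,2) s(1)] s(2) assms(3,5) by (simp add: Let_def)
  finally show ?thesis
    unfolding decrypted_def s(1) using key_received[OF edge_cyclesD(4)[OF assms(1)]]
    by (simp add: add.assoc)
qed

text \<open>The direct bit contains the sum of all shares, which the shares arriving around the
  cycles cancel.\<close>

lemma received_bit_correct:
  assumes "{z, v} \<in> E" "b < B" "\<And>s. s \<le> d * c \<Longrightarrow> key_rounds + slot t b s < T"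
  shows "received_bit v \<C> h t b z = of_bool (encode_bit (m t z v) b)"
proof -
  let ?share = "\<lambda>C. arc_key r (z, across C z v) (hop_slot \<C> t b 0 C (z, across C z v))"
  have "decrypted h (across C v z) (hop_slot \<C> t b (card C - 2) C (across C v z, v)) = ?share C"
    if C: "C \<in> edge_cycles \<C> v z" for C
  proof -
    have y: "C \<in> edge_cycles \<C> (across C v z) v"
      using across_in(1)[OF C] by (simp add: edge_cycles_commute)
    have j: "card C - 2 < card C - 1" "Suc (card C - 2) = card C - 1"
      using edge_cyclesD(5)[OF C] by simp_all
    obtain s where s: "hop_slot \<C> t b (card C - 2) C (across C v z, v) = slot t b s" "s < d * c"
      using hop_slot_eq[of C "(across C v z, v)" "card C - 2" t b] y j(1) by auto
    \<comment> \<open>The last hop into \<open>v\<close> is one arc behind \<open>(v, z)\<close>.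
      Going back \<open>card C - 2\<close> more arcs completes the round trip and ends at the first
      hop out of \<open>z\<close>.\<close>
    have "(pred_arc C ^^ (card C - 2)) (across C v z, v) =
        (pred_arc C ^^ Suc (card C - 2)) (v, z)"
      by (simp add: funpow_Suc_right pred_arc_def del: funpow.simps)
    also have "\<dots> = (z, across C z v)"
      unfolding j(2) by (rule pred_arc_round_trip[OF edge_cyclesD(2,3)[OF C]])
    finally show ?thesis using y j(1) assms(2,3) s by (intro decrypted_hop) auto
  qed
  then have "(\<Sum>C\<in>edge_cycles \<C> v z.
      decrypted h (across C v z) (hop_slot \<C> t b (card C - 2) C (across C v z, v))) =
      (\<Sum>C\<in>edge_cycles \<C> z v. ?share C)"
    unfolding edge_cycles_commute[of \<C> z v] by (intro sum.cong refl) simp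
  moreover have "decrypted h z (slot t b (d * c)) =
      of_bool (encode_bit (m t z v) b) + (\<Sum>C\<in>edge_cycles \<C> z v. ?share C)"
    unfolding decrypted_def using received_slot[OF assms(1,2) order.refl assms(3)] key_received[OF assms(1)]
    by (simp add: slot_bit_def add.assoc)
  ultimately show ?thesis unfolding received_bit_def by (simp add: add.assoc)
qed

lemma simulated_correct:
  assumes "\<And>t' b s. t' < t \<Longrightarrow> b < B \<Longrightarrow> s \<le> d * c \<Longrightarrow> key_rounds + slot t' b s < T"
    and "\<And>t' u. length (m t' u v) < B" "\<And>t' u. {u, v} \<notin> E \<Longrightarrow> m t' u v = []"
  shows "simulated v (nbrs E v) \<C> h t = map (\<lambda>s u. m s u v) [0..<t]"
proof -
  have "decode (map (\<lambda>b. received_bit v \<C> h s b u = 1) [0..<B]) = m s u v"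
    if "s < t" "{u, v} \<in> E" for s u
  proof -
    have "map (\<lambda>b. received_bit v \<C> h s b u = 1) [0..<B] = map (encode_bit (m s u v)) [0..<B]"
      using that assms(1) received_bit_correct by (intro map_cong) auto
    then show ?thesis by (simp only: decode_encode[OF assms(2)])
  qed
  then show ?thesis
    using assms(3) by (auto simp: simulated_def nbrs_def fun_eq_iff)
qed

end

section \<open>Locality: a node needs only the cycles through it\<close>

definition local_cover :: "nat \<Rightarrow> cycle set" where
  "local_cover v = {C \<in> \<C>. v \<in> \<Union>C}"

lemma with_cover_eq: "with_cover \<C> x v = (local_cover v, x v)"
  by (simp add: with_cover_def local_cover_def)

lemma edge_cycles_local:
  assumes "v = a \<or> v = b"
  shows "edge_cycles (local_cover v) a b = edge_cycles \<C> a b"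
  using assms by (auto simp: edge_cycles_def local_cover_def)

lemma hop_slot_local:
  "hop_slot (local_cover v) t b j C (v, z) = hop_slot \<C> t b j C (v, z)"
  "hop_slot (local_cover v) t b j C (z, v) = hop_slot \<C> t b j C (z, v)"
  using edge_cycles_local[of v] by (simp_all add: hop_slot_def)

text \<open>Every cycle that \<open>v\<close> looks up contains an edge at \<open>v\<close>, so the
  full cover may replace the part that \<open>v\<close> was given.\<close>

lemma compiled_local:
  "compiled_bit v Nb (local_cover v) x \<omega> h z = compiled_bit v Nb \<C> x \<omega> h z"
  "compiled_out v Nb (local_cover v) x \<omega> h = compiled_out v Nb \<C> x \<omega> h"
proof -
  have "received_bit v (local_cover v) = received_bit v \<C>"
    using edge_cycles_local[of v] by (intro ext) (simp add: received_bit_def hop_slot_local)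
  then have sim: "simulated v Nb (local_cover v) = simulated v Nb \<C>"
    by (intro ext) (simp only: simulated_def)
  then show "compiled_out v Nb (local_cover v) x \<omega> h = compiled_out v Nb \<C> x \<omega> h"
    by (simp add: compiled_out_def)
  show "compiled_bit v Nb (local_cover v) x \<omega> h z = compiled_bit v Nb \<C> x \<omega> h z"
    using edge_cycles_local[of v] sim
    by (simp add: compiled_bit_def relayed_bit_def direct_bit_def hop_slot_local Let_def)
qed

end

section \<open>Executions of the compiled algorithm follow the transcript\<close>

locale compiled_execution = covered_graph A R B N d c V E \<C>
  for A :: "('i, 'o) algorithm" and R B N d c :: nat and V :: "nat set" and E :: "edge set"
    and \<C> :: "cycle set" +
  fixes x :: "nat \<Rightarrow> 'i" and \<omega> :: "nat \<Rightarrow> bool list"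
  assumes short: "length (messages A E x (coins_of A \<omega>) t u v) < B"
    and halts: "halts_within A V E x (coins_of A \<omega>) R"
begin

definition msgs :: "nat \<Rightarrow> nat \<Rightarrow> nat \<Rightarrow> msg" where
  "msgs = messages A E x (coins_of A \<omega>)"

definition rand :: "nat \<Rightarrow> nat \<Rightarrow> nat \<Rightarrow> bit" where
  "rand u = own_bit (\<omega> u)"

definition transcript_history :: "nat \<Rightarrow> nat \<Rightarrow> history" where
  "transcript_history v T = map (\<lambda>\<tau> u. transcript E \<C> msgs rand \<tau> u v) [0..<T]"

lemma msgs_props: "length (msgs t u v) < B" "{u, v} \<notin> E \<Longrightarrow> msgs t u v = []"
  unfolding msgs_def using short by (simp_all add: messages_def sent_def)

lemma length_transcript_history [simp]: "length (transcript_history v T) = T"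
  by (simp add: transcript_history_def)

lemma simulated_transcript:
  assumes "key_rounds \<le> T" "T \<le> total_rounds"
    and "\<And>t' b s. t' < t \<Longrightarrow> b < B \<Longrightarrow> s \<le> d * c \<Longrightarrow> key_rounds + slot t' b s < T"
  shows "simulated v (nbrs E v) \<C> (transcript_history v T) t = histories A E x (coins_of A \<omega>) t v"
  using simulated_correct[OF transcript_history_def assms(1,2,3) msgs_props]
  by (simp add: histories_eq_map_messages msgs_def)

lemma relayed_bit_correct:
  assumes "t < R" "b < B" "s < d * c" "{v, z} \<in> E"
  shows "relayed_bit v \<C> (\<omega> v) (transcript_history v (key_rounds + slot t b s)) t b s z =
    slot_bit \<C> msgs rand t b s v z"
proof -
  define X where "X = edge_cycles \<C> v z"
  define C where "C = cycle_at X (s mod c)"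
  define j where "j = s div c"
  define y where "y = across C v z"
  let ?T = "key_rounds + slot t b s"
  let ?p = "(pred_arc C ^^ j) (v, z)"
  have c: "c \<noteq> 0" using assms(3) by (cases c) auto
  have key: "key (own_bit (\<omega> v) z) q = arc_key rand (v, z) q" for q
    by (simp add: arc_key_def rand_def)
  show ?thesis
  proof (cases "s mod c < card X \<and> j < card C - 1")
    case True
    then have C: "C \<in> edge_cycles \<C> v z" and idx: "cycle_index X C = s mod c"
      using cycle_at_in[of X "s mod c"] cycle_index_at[of X "s mod c"] by (simp_all add: X_def C_def)
    show ?thesis
    proof (cases "j = 0")
      case True
      \<comment> \<open>In hop 0 the share and its encryption are the same key bit, so their sum is
        the 0 that is sent.\<close>
      then have "hop_slot \<C> t b 0 C (v, z) = slot t b s"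
        using c idx by (simp add: hop_slot_def X_def j_def div_eq_0_iff)
      then show ?thesis
        using True assms(3)
        by (simp add: relayed_bit_def slot_bit_def Let_def flip: X_def C_def j_def)
    next
      case False
      have yv: "C \<in> edge_cycles \<C> y v"
        using across_in(1)[OF C] by (simp add: edge_cycles_commute y_def)
      have j: "j - 1 < card C - 1" "Suc (j - 1) = j" using True False by auto
      obtain s' where s': "hop_slot \<C> t b (j - 1) C (y, v) = slot t b s'" "s' < Suc (j - 1) * c"
        using hop_slot_eq[of C "(y, v)" "j - 1" t b] yv j(1) by auto
      \<comment> \<open>All slots of hop \<open>j - 1\<close> precede those of hop \<open>j\<close>,
        so the share to be forwarded has already arrived.\<close>
      have "j * c \<le> s" by (simp add: j_def)
      then have less: "hop_slot \<C> t b (j - 1) C (y, v) < slot t b s"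
        using s' unfolding j(2) by (simp add: slot_def)
      have "(pred_arc C ^^ (j - 1)) (y, v) = (pred_arc C ^^ Suc (j - 1)) (v, z)"
        by (simp add: funpow_Suc_right pred_arc_def y_def del: funpow.simps)
      then have p: "(pred_arc C ^^ (j - 1)) (y, v) = ?p" unfolding j(2) .
      have "?T \<le> total_rounds"
        using slot_less[OF assms(1,2), of s] assms(3) by (simp add: total_rounds_def)
      then have "decrypted (transcript_history v ?T) y (hop_slot \<C> t b (j - 1) C (y, v)) =
          arc_key rand ?p (hop_slot \<C> t b 0 C ?p)"
        using decrypted_hop[OF transcript_history_def _ _ yv j(1) assms(2) _ p] less by simp
      then show ?thesis
        using True False assms(3)
        by (simp add: relayed_bit_def slot_bit_def Let_def key flip: X_def C_def j_def y_def)
    qed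
  next
    case False
    then show ?thesis
      using assms(3) by (auto simp: relayed_bit_def slot_bit_def Let_def simp flip: X_def C_def j_def)
  qed
qed

lemma direct_bit_correct:
  assumes "t < R" "b < B" "{v, z} \<in> E"
  shows "direct_bit v (nbrs E v) \<C> (x v) (\<omega> v)
      (transcript_history v (key_rounds + slot t b (d * c))) t b z =
    slot_bit \<C> msgs rand t b (d * c) v z"
proof -
  have "key_rounds + slot t b (d * c) \<le> total_rounds"
    using slot_less[OF assms(1,2), of "d * c"] by (simp add: total_rounds_def)
  then have "simulated v (nbrs E v) \<C> (transcript_history v (key_rounds + slot t b (d * c))) t =
      histories A E x (coins_of A \<omega>) t v"
    using slot_less_slot[of _ t] by (intro simulated_transcript) auto
  then show ?thesis
    using assms(3)
    by (simp add: direct_bit_def slot_bit_def Let_def arc_key_def rand_def msgs_def messages_def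
        sent_def coins_of_def)
qed

lemma compiled_bit_correct:
  assumes "{v, z} \<in> E" "T < total_rounds"
  shows "[compiled_bit v (nbrs E v) \<C> (x v) (\<omega> v) (transcript_history v T) z = 1] =
    transcript E \<C> msgs rand T v z"
proof -
  show ?thesis
  proof (cases "T < key_rounds")
    case True
    then show ?thesis using assms by (simp add: compiled_bit_def transcript_def rand_def)
  next
    case False
    then have "T - key_rounds < num_slots" using assms(2) by (simp add: total_rounds_def)
    then obtain t b s where q: "t < R" "b < B" "s \<le> d * c" "T - key_rounds = slot t b s"
      by (rule slot_cases)
    then have T: "T = key_rounds + slot t b s" using False by simp
    note dm = slot_div_mod[OF q(2,3), of t]
    have "transcript E \<C> msgs rand T v z = [slot_bit \<C> msgs rand t b s v z = 1]"
      using False assms dm by (simp add: transcript_def q(4))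
    moreover have "compiled_bit v (nbrs E v) \<C> (x v) (\<omega> v) (transcript_history v T) z =
        slot_bit \<C> msgs rand t b s v z"
    proof (cases "s < d * c")
      case True
      then show ?thesis
        using False dm relayed_bit_correct[OF q(1,2) True assms(1)]
        by (simp add: compiled_bit_def q(4) flip: T)
    next
      case s: False
      then have eq: "s = d * c" using q(3) by simp
      note T' = T[unfolded eq]
      show ?thesis
        using False dm direct_bit_correct[OF q(1,2) assms(1)] eq
        by (simp add: compiled_bit_def q(4) flip: T')
    qed
    ultimately show ?thesis by simp
  qed
qed

lemma compiled_out_early: "length h < total_rounds \<Longrightarrow> compiled_out v Nb \<C>' y w h = None"
  by (simp add: compiled_out_def)

lemma compiled_out_final:
  assumes "v \<in> V"
  shows "compiled_out v (nbrs E v) \<C> (x v) (\<omega> v) (transcript_history v total_rounds) =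
    final_output A E x (coins_of A \<omega>) v"
    and "final_output A E x (coins_of A \<omega>) v \<noteq> None"
proof -
  let ?H = "\<lambda>t. histories A E x (coins_of A \<omega>) t v"
  let ?P = "\<lambda>t. out_after A E x (coins_of A \<omega>) t v \<noteq> None"
  have sim: "simulated v (nbrs E v) \<C> (transcript_history v total_rounds) R = ?H R"
    using slot_less by (intro simulated_transcript) (auto simp: total_rounds_def)
  define o' where "o' t = out A v (nbrs E v) (x v) (coins_of A \<omega> v) (take t (?H R))" for t
  have o': "o' t = out_after A E x (coins_of A \<omega>) t v" if "t \<le> R" for t
    using that by (simp add: o'_def out_after_def histories_take)
  obtain t where t: "t \<le> R" "?P t" using halts assms unfolding halts_within_def by blast
  have least: "?P (Least ?P)" "Least ?P \<le> R"
    using LeastI[of ?P, OF t(2)] Least_le[of ?P, OF t(2)] t(1) by simp_all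
  \<comment> \<open>\<open>A\<close> halts by round \<open>R\<close>, so its first output is found
    within the simulated history, before truncation by \<open>take\<close> has an effect.\<close>
  have "(LEAST t. o' t \<noteq> None) = Least ?P"
  proof (rule Least_equality)
    show "o' (Least ?P) \<noteq> None" using least by (simp add: o')
    show "Least ?P \<le> s" if "o' s \<noteq> None" for s
    proof (cases "s \<le> R")
      case True
      then show ?thesis using that by (intro Least_le) (simp add: o')
    next
      case False
      then show ?thesis using least by simp
    qed
  qed
  moreover have "compiled_out v (nbrs E v) \<C> (x v) (\<omega> v) (transcript_history v total_rounds) =
      o' (LEAST t. o' t \<noteq> None)"
    by (simp add: compiled_out_def sim o'_def coins_of_def Let_def)
  ultimately show "compiled_out v (nbrs E v) \<C> (x v) (\<omega> v) (transcript_history v total_rounds) =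
    final_output A E x (coins_of A \<omega>) v"
    using least by (simp add: final_output_def o')
  show "final_output A E x (coins_of A \<omega>) v \<noteq> None"
    using least by (simp add: final_output_def)
qed

lemma halted_transcript_iff:
  assumes "v \<in> V"
  shows "halted compiled_algorithm v (nbrs E v) (with_cover \<C> x v) (\<omega> v) (transcript_history v T) \<longleftrightarrow>
    total_rounds \<le> T"
proof
  assume "halted compiled_algorithm v (nbrs E v) (with_cover \<C> x v) (\<omega> v) (transcript_history v T)"
  then obtain t where t: "t \<le> T"
    "compiled_out v (nbrs E v) \<C> (x v) (\<omega> v) (take t (transcript_history v T)) \<noteq> None"
    by (auto simp: halted_def with_cover_eq compiled_local)
  have "\<not> length (take t (transcript_history v T)) < total_rounds"
  proof
    assume "length (take t (transcript_history v T)) < total_rounds"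
    from t(2) compiled_out_early[OF this] show False by (rule notE)
  qed
  then show "total_rounds \<le> T" using t(1) by simp
next
  assume "total_rounds \<le> T"
  moreover from this
  have "take total_rounds (transcript_history v T) = transcript_history v total_rounds"
    by (simp add: transcript_history_def take_map)
  ultimately show
    "halted compiled_algorithm v (nbrs E v) (with_cover \<C> x v) (\<omega> v) (transcript_history v T)"
    using compiled_out_final[OF assms] unfolding halted_def
    by (intro exI[of _ total_rounds]) (simp add: with_cover_eq compiled_local)
qed

theorem messages_compiled:
  "messages compiled_algorithm E (with_cover \<C> x) \<omega> = transcript E \<C> msgs rand"
proof (rule messages_eqI)
  fix T u v
  let ?H = "\<lambda>v. map (\<lambda>s u. transcript E \<C> msgs rand s u v) [0..<T]"
  have H: "?H u = transcript_history u T" by (simp add: transcript_history_def)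
  show "sent compiled_algorithm E (with_cover \<C> x) \<omega> ?H u v = transcript E \<C> msgs rand T u v"
  proof (cases "{u, v} \<in> E \<and> T < total_rounds")
    case True
    then show ?thesis
      using halted_transcript_iff[of u T] edge_in_V[of u v] compiled_bit_correct[of u v T]
      unfolding sent_def H by (simp add: with_cover_eq compiled_local)
  next
    case False
    then show ?thesis
      using halted_transcript_iff[of u T] edge_in_V[of u v]
      unfolding sent_def H by (auto simp: transcript_def)
  qed
qed

lemma messages_compiled_eq:
  "messages compiled_algorithm E (with_cover \<C> x) \<omega> =
    transcript E \<C> (messages A E x (coins_of A \<omega>)) (\<lambda>u. own_bit (\<omega> u))"
  unfolding messages_compiled msgs_def rand_def ..

lemma histories_compiled:
  "histories compiled_algorithm E (with_cover \<C> x) \<omega> T v = transcript_history v T"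
  by (simp add: histories_eq_map_messages messages_compiled transcript_history_def)

lemma out_after_compiled:
  "out_after compiled_algorithm E (with_cover \<C> x) \<omega> T v =
    compiled_out v (nbrs E v) \<C> (x v) (\<omega> v) (transcript_history v T)"
  by (simp add: out_after_def histories_compiled with_cover_eq compiled_local)

lemma halts_within_compiled: "halts_within compiled_algorithm V E (with_cover \<C> x) \<omega> total_rounds"
  unfolding halts_within_def out_after_compiled using compiled_out_final by auto

lemma final_output_compiled:
  assumes "v \<in> V"
  shows "final_output compiled_algorithm E (with_cover \<C> x) \<omega> v =
    final_output A E x (coins_of A \<omega>) v"
proof -
  have "(LEAST t. out_after compiled_algorithm E (with_cover \<C> x) \<omega> t v \<noteq> None) = total_rounds"
  proof (rule Least_equality)
    show "out_after compiled_algorithm E (with_cover \<C> x) \<omega> total_rounds v \<noteq> None"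
      using compiled_out_final[OF assms] by (simp add: out_after_compiled)
    show "total_rounds \<le> t"
      if "out_after compiled_algorithm E (with_cover \<C> x) \<omega> t v \<noteq> None" for t
      using that compiled_out_early[of "transcript_history v t"]
      by (fastforce simp: out_after_compiled not_le[symmetric])
  qed
  then show ?thesis
    using compiled_out_final[OF assms] by (simp add: final_output_def[of compiled_algorithm] out_after_compiled)
qed

lemma length_messages_compiled:
  "length (messages compiled_algorithm E (with_cover \<C> x) \<omega> t u v) \<le> 1"
  by (simp add: messages_compiled transcript_def)

end

section \<open>Hiding the messages\<close>

context compiler
begin

lemma key_add: "key (\<lambda>j. f j + g j) q = key f q + key g q"
  by (simp add: key_def distrib_left sum.distrib)

lemma key_cong: "(\<And>j. j < key_rounds \<Longrightarrow> f j = g j) \<Longrightarrow> key f q = key g q"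
  by (simp add: key_def)

end

section \<open>Changing keys to compensate for changed messages\<close>

context covered_graph
begin

text \<open>The change of the keys that hides a change \<open>\<delta>\<close> of the messages: over a good edge, the key of the
  direct share is flipped; for a bad edge, the keys along one cycle all of whose other edges are good.\<close>

definition flip :: "edge set \<Rightarrow> (nat \<Rightarrow> nat \<Rightarrow> cycle) \<Rightarrow> (nat \<Rightarrow> nat \<Rightarrow> nat \<Rightarrow> nat \<Rightarrow> bit) \<Rightarrow>
    nat \<times> nat \<Rightarrow> nat \<Rightarrow> bit" where
  "flip bad detour \<delta> p q =
     (let t = q div (d * c + 1) div B; b = q div (d * c + 1) mod B; s = q mod (d * c + 1)
      in if s < d * c
         then let X = edge_cycles \<C> (fst p) (snd p); C = cycle_at X (s mod c);
                  (v, u) = (pred_arc C ^^ Suc (s div c)) p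
              in if s mod c < card X \<and> s div c < card C - 1 \<and> {u, v} \<in> bad \<and> C = detour u v
                 then \<delta> t b u v else 0
         else if {fst p, snd p} \<in> bad then 0 else \<delta> t b (fst p) (snd p))"

text \<open>One arc before the first hop of a share from \<open>u\<close> to \<open>v\<close> lies
  \<open>(v, u)\<close>. So \<open>Suc j\<close> steps back from hop \<open>j\<close> reveal which
  message the share belongs to.\<close>

lemma flip_hop:
  assumes "C \<in> edge_cycles \<C> (fst p) (snd p)" "j < card C - 1" "b < B"
    and "(pred_arc C ^^ Suc j) p = (v, u)"
  shows "flip bad detour \<delta> p (hop_slot \<C> t b j C p) =
    (if {u, v} \<in> bad \<and> C = detour u v then \<delta> t b u v else 0)"
proof -
  obtain s where s: "hop_slot \<C> t b j C p = slot t b s" "s < d * c" "s div c = j"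
    "s mod c = cycle_index (edge_cycles \<C> (fst p) (snd p)) C"
    using hop_slot_eq[OF assms(1,2)] by metis
  have dm: "slot t b s div (d * c + 1) div B = t" "slot t b s div (d * c + 1) mod B = b"
    "slot t b s mod (d * c + 1) = s"
    using slot_div_mod[OF assms(3), of s t] s(2) by simp_all
  have at: "cycle_at (edge_cycles \<C> (fst p) (snd p)) (s mod c) = C"
    "s mod c < card (edge_cycles \<C> (fst p) (snd p))"
    using assms(1) unfolding s(4) by (simp_all add: cycle_at_index cycle_index_less)
  show ?thesis
    unfolding flip_def s(1) dm Let_def at(1) s(3) assms(4) using s(2) at(2) assms(2) by simp
qed

lemma flip_direct:
  assumes "b < B"
  shows "flip bad detour \<delta> (u, v) (slot t b (d * c)) = (if {u, v} \<in> bad then 0 else \<delta> t b u v)"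
  using slot_div_mod[OF assms order.refl, of t] by (simp add: flip_def del: One_nat_def)

context
  fixes bad :: "edge set" and detour :: "nat \<Rightarrow> nat \<Rightarrow> cycle" and \<delta> :: "nat \<Rightarrow> nat \<Rightarrow> nat \<Rightarrow> nat \<Rightarrow> bit"
  assumes detour: "\<And>u v. {u, v} \<in> E \<Longrightarrow> {u, v} \<in> bad \<Longrightarrow>
    detour u v \<in> edge_cycles \<C> u v \<and> detour u v \<inter> bad \<subseteq> {{u, v}}"
begin

text \<open>Keys of bad edges may be known and must stay. A flipped hop key lies on a detour, which
  meets no bad edge except the one it bypasses, and no hop crosses that one.\<close>

lemma flip_bad:
  assumes "{fst p, snd p} \<in> E" "{fst p, snd p} \<in> bad" "q < num_slots"
  shows "flip bad detour \<delta> p q = 0"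
proof -
  obtain t b s where q: "t < R" "b < B" "s \<le> d * c" "q = slot t b s"
    using slot_cases[OF assms(3)] .
  note dm = slot_div_mod[OF q(2,3), of t]
  define X where "X = edge_cycles \<C> (fst p) (snd p)"
  define C where "C = cycle_at X (s mod c)"
  obtain v u where vu: "(pred_arc C ^^ Suc (s div c)) p = (v, u)" by fastforce
  have "\<not> ({u, v} \<in> bad \<and> C = detour u v)" if "s mod c < card X" "s div c < card C - 1"
  proof
    assume bad: "{u, v} \<in> bad \<and> C = detour u v"
    have C: "C \<in> edge_cycles \<C> (fst p) (snd p)"
      using cycle_at_in[of X "s mod c"] that(1) by (simp add: X_def C_def)
    have "C \<in> edge_cycles \<C> v u" using pred_arc_in[OF C, of "Suc (s div c)" "(v, u)"] vu by simp
    then have "{u, v} \<in> E" using edge_cyclesD(4)[of C v u] by (simp add: insert_commute)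
    then have "C \<inter> bad \<subseteq> {{u, v}}" using bad detour by blast
    then have "{fst p, snd p} = {v, u}"
      using edge_cyclesD(3)[OF C] assms(2) by (auto simp: insert_commute)
    moreover have "{v, u} \<noteq> {fst p, snd p}"
      using vu that(2) by (intro pred_arc_iterate_in_cycle(2)[OF edge_cyclesD(2,3)[OF C]]) auto
    ultimately show False by simp
  qed
  then show ?thesis
    using assms(2)
    by (auto simp: flip_def q(4) dm Let_def vu simp flip: X_def C_def simp del: funpow.simps One_nat_def)
qed

text \<open>In a hop slot, the share and the key encrypting it change together. In a direct slot,
  the change \<delta> of the message bit is cancelled by the key of the edge if that is good, and by
  a single share if it is bad.\<close>

lemma slot_bit_flip:
  assumes r: "\<And>p q. {fst p, snd p} \<in> E \<Longrightarrow> q < num_slots \<Longrightarrow>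
      arc_key r' p q = arc_key r p q + flip bad detour \<delta> p q"
    and m: "of_bool (encode_bit (m' t u v) b) = of_bool (encode_bit (m t u v) b) + \<delta> t b u v"
    and uv: "{u, v} \<in> E" and tbs: "t < R" "b < B" "s \<le> d * c"
  shows "slot_bit \<C> m' r' t b s u v = slot_bit \<C> m r t b s u v"
proof (cases "s < d * c")
  case True
  define X where "X = edge_cycles \<C> u v"
  define C where "C = cycle_at X (s mod c)"
  define j where "j = s div c"
  define p where "p = (pred_arc C ^^ j) (u, v)"
  have "arc_key r' p (hop_slot \<C> t b 0 C p) + arc_key r' (u, v) (slot t b s) =
      arc_key r p (hop_slot \<C> t b 0 C p) + arc_key r (u, v) (slot t b s)"
    if ij: "s mod c < card X" "j < card C - 1"
  proof -
    have C: "C \<in> edge_cycles \<C> u v" and idx: "cycle_index X C = s mod c"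
      using cycle_at_in[of X "s mod c"] cycle_index_at[of X "s mod c"] ij
      by (simp_all add: X_def C_def)
    have Cp: "C \<in> edge_cycles \<C> (fst p) (snd p)"
      by (rule pred_arc_in[OF C]) (simp add: p_def)
    have slot: "slot t b s = hop_slot \<C> t b j C (u, v)"
      using idx by (simp add: hop_slot_def X_def j_def)
    obtain y x where yx: "(pred_arc C ^^ Suc j) (u, v) = (y, x)" by fastforce
    then have yx': "(pred_arc C ^^ Suc 0) p = (y, x)" by (simp add: p_def)
    have pos: "0 < card C - 1" using ij(2) by simp
    obtain s' where s': "hop_slot \<C> t b 0 C p = slot t b s'" "s' < d * c"
      using hop_slot_eq[OF Cp pos] by metis
    \<comment> \<open>Both keys are traced back to the same arc \<open>(y, x)\<close>, so they are
      flipped by the same amount.\<close>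
    have "flip bad detour \<delta> (u, v) (slot t b s) = flip bad detour \<delta> p (hop_slot \<C> t b 0 C p)"
      unfolding slot using flip_hop[OF Cp pos tbs(2) yx'] flip_hop[of C "(u, v)", OF _ ij(2) tbs(2) yx] C
      by simp
    moreover have "hop_slot \<C> t b 0 C p < num_slots" "slot t b s < num_slots"
      using s' tbs slot_less by simp_all
    ultimately show ?thesis
      using r[of p] r[of "(u, v)"] uv edge_cyclesD(4)[OF Cp] by (simp add: ac_simps)
  qed
  then show ?thesis
    using True by (auto simp: slot_bit_def Let_def simp flip: X_def C_def j_def p_def)
next
  case False
  then have s: "s = d * c" using tbs(3) by simp
  let ?share = "\<lambda>r C. arc_key r (u, across C u v) (hop_slot \<C> t b 0 C (u, across C u v))"
  have share: "?share r' C = ?share r C +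
      (if C = detour u v then if {u, v} \<in> bad then \<delta> t b u v else 0 else 0)"
    if C: "C \<in> edge_cycles \<C> u v" for C
  proof -
    have w: "C \<in> edge_cycles \<C> u (across C u v)" using across_in(1)[OF C] .
    have pos: "0 < card C - 1" using edge_cyclesD(5)[OF C] by simp
    have "(pred_arc C ^^ Suc 0) (u, across C u v) = (v, u)"
      using across_in(2)[OF C] by (simp add: pred_arc_def)
    then have "flip bad detour \<delta> (u, across C u v) (hop_slot \<C> t b 0 C (u, across C u v)) =
        (if C = detour u v then if {u, v} \<in> bad then \<delta> t b u v else 0 else 0)"
      using flip_hop[of C "(u, across C u v)" 0 b v u] w pos tbs(2) by simp
    moreover obtain s' where s': "hop_slot \<C> t b 0 C (u, across C u v) = slot t b s'" "s' < d * c"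
      using hop_slot_eq[of C "(u, across C u v)" 0 t b] w pos by auto
    then have "hop_slot \<C> t b 0 C (u, across C u v) < num_slots" using tbs slot_less by simp
    ultimately show ?thesis using r[of "(u, across C u v)"] edge_cyclesD(4)[OF w] by simp
  qed
  \<comment> \<open>For a bad edge exactly one cycle in the sum is its detour, so \<delta> enters
    exactly once.\<close>
  have "(\<Sum>C\<in>edge_cycles \<C> u v. ?share r' C) =
      (\<Sum>C\<in>edge_cycles \<C> u v. ?share r C) + (if {u, v} \<in> bad then \<delta> t b u v else 0)"
    using detour[OF uv] by (simp add: share sum.distrib)
  moreover have "arc_key r' (u, v) (slot t b (d * c)) =
      arc_key r (u, v) (slot t b (d * c)) + (if {u, v} \<in> bad then 0 else \<delta> t b u v)"
    using r[of "(u, v)"] uv slot_less[OF tbs(1,2) order.refl] flip_direct[OF tbs(2)] by simp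
  ultimately show ?thesis
    by (simp add: slot_bit_def s m ac_simps)
qed

end

end

section \<open>The eavesdropper in the key phase: bad edges and detours\<close>

locale eavesdropped = covered_graph A R B N d c V E \<C>
  for A :: "('i, 'o) algorithm" and R B N d c :: nat and V :: "nat set" and E :: "edge set"
    and \<C> :: "cycle set" +
  fixes k k' \<eta> :: nat and \<sigma> :: "observation list \<Rightarrow> edge set"
  assumes ids: "v \<in> V \<Longrightarrow> v < N"
    and covering: "e \<in> E \<Longrightarrow> \<exists>\<C>e. \<C>e \<subseteq> \<C> \<and> finite \<C>e \<and> card \<C>e = k \<and> (\<forall>C\<in>\<C>e. e \<in> C) \<and>
        (\<forall>e'\<in>E - {e}. card {C \<in> \<C>e. e' \<in> C} \<le> \<eta>)"
    and eavesdropper: "eavesdropper E k' \<sigma>"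
    and budget: "0 < k' \<Longrightarrow> \<eta> * (8 * k') < k"
begin

text \<open>In the first \<open>key_rounds\<close> rounds the transcript does not depend on the
  messages; the empty ones are placeholders.\<close>

abbreviation key_view :: "(nat \<Rightarrow> nat \<Rightarrow> nat \<Rightarrow> bit) \<Rightarrow> nat \<Rightarrow> observation list" where
  "key_view r \<equiv> view \<sigma> (transcript E \<C> (\<lambda>_ _ _. []) r)"

definition listened :: "(nat \<Rightarrow> nat \<Rightarrow> nat \<Rightarrow> bit) \<Rightarrow> edge \<Rightarrow> nat set" where
  "listened r e = {j. j < key_rounds \<and> e \<in> \<sigma> (key_view r j)}"

definition bad_edges :: "(edge \<Rightarrow> nat set) \<Rightarrow> edge set" where
  "bad_edges L = {e \<in> E. num_slots < card (L e)}"

definition detour :: "(edge \<Rightarrow> nat set) \<Rightarrow> nat \<Rightarrow> nat \<Rightarrow> cycle" where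
  "detour L u v = (SOME C. C \<in> edge_cycles \<C> u v \<and> C \<inter> bad_edges L \<subseteq> {{u, v}})"

text \<open>The choice is made from \<open>L\<close> and \<delta> alone, so runs with the same
  listened rounds get the same change; this is what makes \<open>mask\<close> an involution.\<close>

definition hiding :: "(edge \<Rightarrow> nat set) \<Rightarrow> (nat \<Rightarrow> nat \<Rightarrow> nat \<Rightarrow> nat \<Rightarrow> bit) \<Rightarrow>
    nat \<Rightarrow> nat \<Rightarrow> nat \<Rightarrow> bit" where
  "hiding L \<delta> u v = (SOME z. (\<forall>j\<in>L {u, v}. z j = 0) \<and>
     (\<forall>q<num_slots. key z q = flip (bad_edges L) (detour L) \<delta> (u, v) q))"

lemma sigma: "\<sigma> o' \<subseteq> E" "card (\<sigma> o') \<le> k'"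
  using eavesdropper by (simp_all add: eavesdropper_def)

text \<open>Double counting: the first phase allows \<open>8 * num_slots * k'\<close> observations
  of an edge in a round, and each bad edge uses up more than \<open>num_slots\<close> of
  them.\<close>

lemma card_bad_edges: "card (bad_edges (listened r)) \<le> 8 * k'"
proof -
  let ?bad = "bad_edges (listened r)"
  have fin: "finite ?bad" using finite_E by (simp add: bad_edges_def)
  have "card ?bad * Suc num_slots \<le> (\<Sum>e\<in>?bad. card (listened r e))"
    using sum_mono[of ?bad "\<lambda>_. Suc num_slots" "\<lambda>e. card (listened r e)"]
    by (simp add: bad_edges_def Suc_le_eq)
  also have "\<dots> = (\<Sum>e\<in>?bad. \<Sum>j<key_rounds. of_bool (e \<in> \<sigma> (key_view r j)))"
    by (intro sum.cong refl) (simp add: listened_def Int_def conj_commute)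
  also have "\<dots> = (\<Sum>j<key_rounds. \<Sum>e\<in>?bad. of_bool (e \<in> \<sigma> (key_view r j)))"
    by (rule sum.swap)
  also have "\<dots> \<le> (\<Sum>j<key_rounds. k')"
  proof (rule sum_mono)
    fix j
    have "(\<Sum>e\<in>?bad. of_bool (e \<in> \<sigma> (key_view r j))) = card (?bad \<inter> \<sigma> (key_view r j))"
      using fin by (simp add: Int_def)
    also have "\<dots> \<le> card (\<sigma> (key_view r j))"
      using sigma(1) finite_E by (intro card_mono) (auto intro: finite_subset)
    finally show "(\<Sum>e\<in>?bad. of_bool (e \<in> \<sigma> (key_view r j))) \<le> k'" using sigma(2) order_trans by blast
  qed
  also have "\<dots> = (8 * k') * num_slots" by (simp add: key_rounds_def)
  also have "\<dots> \<le> (8 * k') * Suc num_slots" by simp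
  finally show ?thesis by (simp only: mult_le_cancel2)
qed

lemma detour_props:
  assumes "{u, v} \<in> E" "{u, v} \<in> bad_edges (listened r)"
  shows "detour (listened r) u v \<in> edge_cycles \<C> u v \<and>
    detour (listened r) u v \<inter> bad_edges (listened r) \<subseteq> {{u, v}}"
proof -
  let ?bad = "bad_edges (listened r)"
  have fin: "finite ?bad" using finite_E by (simp add: bad_edges_def)
  obtain \<C>e where cov: "\<C>e \<subseteq> \<C>" "finite \<C>e" "card \<C>e = k" "\<And>C. C \<in> \<C>e \<Longrightarrow> {u, v} \<in> C"
    "\<And>e'. e' \<in> E - {{u, v}} \<Longrightarrow> card {C \<in> \<C>e. e' \<in> C} \<le> \<eta>"
    using covering[OF assms(1)] by blast
  \<comment> \<open>A bad edge can exist only for positive \<open>k'\<close>, which makes the budget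
    available.\<close>
  have "0 < card ?bad" using assms(2) fin by (auto simp: card_gt_0_iff)
  then have k': "0 < k'" using card_bad_edges[of r] by linarith
  have "card (\<Union>e'\<in>?bad - {{u, v}}. {C \<in> \<C>e. e' \<in> C}) \<le>
      (\<Sum>e'\<in>?bad - {{u, v}}. card {C \<in> \<C>e. e' \<in> C})"
    using fin by (intro card_UN_le) simp
  also have "\<dots> \<le> (\<Sum>e'\<in>?bad - {{u, v}}. \<eta>)"
    by (intro sum_mono cov(5)) (auto simp: bad_edges_def)
  also have "\<dots> \<le> 8 * k' * \<eta>"
    using card_bad_edges[of r] card_mono[OF fin, of "?bad - {{u, v}}"] by (simp add: mult_le_mono1)
  also have "\<dots> < card \<C>e" using budget[OF k'] cov(3) by (simp add: ac_simps)
  finally have less: "card (\<Union>e'\<in>?bad - {{u, v}}. {C \<in> \<C>e. e' \<in> C}) < card \<C>e" .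
  have "finite (\<Union>e'\<in>?bad - {{u, v}}. {C \<in> \<C>e. e' \<in> C})"
    by (rule finite_subset[OF _ cov(2)]) blast
  then have "\<not> \<C>e \<subseteq> (\<Union>e'\<in>?bad - {{u, v}}. {C \<in> \<C>e. e' \<in> C})"
    using less card_mono not_le by blast
  then obtain C where "C \<in> \<C>e" "C \<inter> ?bad \<subseteq> {{u, v}}" by blast
  then have "C \<in> edge_cycles \<C> u v \<and> C \<inter> ?bad \<subseteq> {{u, v}}"
    using cov by (auto simp: edge_cycles_def)
  then show ?thesis unfolding detour_def by (rule someI)
qed

text \<open>On a bad edge the required change is zero. On a good one at most
  \<open>num_slots\<close> rounds were heard, and the extractor realises any change of the key
  outside them.\<close>

lemma hiding_props:
  assumes "{u, v} \<in> E"
  shows "\<forall>j\<in>listened r {u, v}. hiding (listened r) \<delta> u v j = 0"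
    and "\<forall>q<num_slots. key (hiding (listened r) \<delta> u v) q =
      flip (bad_edges (listened r)) (detour (listened r)) \<delta> (u, v) q"
proof -
  let ?L = "listened r"
  let ?flip = "flip (bad_edges ?L) (detour ?L) \<delta> (u, v)"
  have "\<exists>z. (\<forall>j\<in>?L {u, v}. z j = 0) \<and> (\<forall>q<num_slots. key z q = ?flip q)"
  proof (cases "{u, v} \<in> bad_edges ?L")
    case True
    then have "?flip q = 0" if "q < num_slots" for q
      using that assms by (intro flip_bad[OF detour_props]) simp_all
    then show ?thesis by (intro exI[of _ "\<lambda>_. 0"]) (simp add: key_def)
  next
    case False
    then have "?L {u, v} \<subseteq> {..<8 * num_slots}" "card (?L {u, v}) \<le> num_slots"
      using assms by (auto simp: bad_edges_def listened_def key_rounds_def)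
    then show ?thesis
      using extractor_M unfolding extractor_def key_def key_rounds_def by blast
  qed
  then have "(\<forall>j\<in>?L {u, v}. hiding ?L \<delta> u v j = 0) \<and>
      (\<forall>q<num_slots. key (hiding ?L \<delta> u v) q = ?flip q)"
    unfolding hiding_def by (rule someI_ex)
  then show "\<forall>j\<in>?L {u, v}. hiding ?L \<delta> u v j = 0"
    "\<forall>q<num_slots. key (hiding ?L \<delta> u v) q = ?flip q" by blast+
qed

lemma key_view_cong:
  assumes "\<And>u v j. {u, v} \<in> E \<Longrightarrow> j < key_rounds \<Longrightarrow> {u, v} \<in> \<sigma> (view \<sigma> (transcript E \<C> m r) j) \<Longrightarrow>
      r' u v j = r u v j"
    and "T \<le> key_rounds"
  shows "view \<sigma> (transcript E \<C> m' r') T = view \<sigma> (transcript E \<C> m r) T"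
proof (rule view_cong)
  fix t assume "t < T"
  then have t: "t < key_rounds" using assms(2) by simp
  show "observe (\<sigma> (view \<sigma> (transcript E \<C> m r) t)) (transcript E \<C> m' r' t) =
      observe (\<sigma> (view \<sigma> (transcript E \<C> m r) t)) (transcript E \<C> m r t)"
    using t assms(1)[OF _ t] by (auto simp: observe_def transcript_def fun_eq_iff)
qed

text \<open>In the key phase the change vanishes wherever the eavesdropper listens; afterwards every
  bit on every edge stays the same. \<open>r\<close> and \<open>r0\<close> are kept apart because
  they need agree only on edges and in the first phase.\<close>

lemma view_hiding:
  assumes r: "\<And>u v j. {u, v} \<in> E \<Longrightarrow> j < key_rounds \<Longrightarrow> r u v j = r0 u v j"
    and r': "\<And>u v j. {u, v} \<in> E \<Longrightarrow> j < key_rounds \<Longrightarrow>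
      r' u v j = r0 u v j + hiding (listened r0) \<delta> u v j"
    and m: "\<And>t b u v. of_bool (encode_bit (m' t u v) b) = of_bool (encode_bit (m t u v) b) + \<delta> t b u v"
  shows "view \<sigma> (transcript E \<C> m' r') T = view \<sigma> (transcript E \<C> m r) T"
proof (rule view_cong)
  let ?L = "listened r0"
  have key_phase: "view \<sigma> (transcript E \<C> m r) t = key_view r0 t" if "t \<le> key_rounds" for t
    by (rule key_view_cong[OF _ that]) (simp add: r)
  fix t
  let ?F = "\<sigma> (view \<sigma> (transcript E \<C> m r) t)"
  have "transcript E \<C> m' r' t u v = transcript E \<C> m r t u v" if F: "{u, v} \<in> ?F" for u v
  proof -
    have uv: "{u, v} \<in> E" using F sigma(1) by blast
    show ?thesis
    proof (cases "t < key_rounds")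
      case True
      then have "t \<in> ?L {u, v}" using F key_phase[of t] by (simp add: listened_def)
      then have "r' u v t = r u v t" using hiding_props(1)[OF uv] r[OF uv True] r'[OF uv True] by simp
      then show ?thesis using True by (simp add: transcript_def)
    next
      case False
      \<comment> \<open>\<open>key\<close> is linear, so adding \<open>hiding\<close> to the random
        bits adds \<open>flip\<close> to the keys.\<close>
      have keys: "arc_key r' p q = arc_key r p q + flip (bad_edges ?L) (detour ?L) \<delta> p q"
        if p: "{fst p, snd p} \<in> E" and q: "q < num_slots" for p q
      proof -
        have "arc_key r' p q = key (\<lambda>j. r (fst p) (snd p) j + hiding ?L \<delta> (fst p) (snd p) j) q"
          unfolding arc_key_def using p by (intro key_cong) (simp add: r r')
        then show ?thesis using hiding_props(2)[OF p, of r0 \<delta>] q by (simp add: key_add arc_key_def)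
      qed
      show ?thesis
      proof (cases "t < total_rounds")
        case True
        then have "t - key_rounds < num_slots" using False by (simp add: total_rounds_def)
        then obtain t' b s where q: "t' < R" "b < B" "s \<le> d * c" "t - key_rounds = slot t' b s"
          by (rule slot_cases)
        note dm = slot_div_mod[OF q(2,3), of t']
        have "slot_bit \<C> m' r' t' b s u v = slot_bit \<C> m r t' b s u v"
          by (rule slot_bit_flip[where bad = "bad_edges ?L" and detour = "detour ?L" and \<delta> = \<delta>
                and r = r and r' = r' and m = m and m' = m'])
              (simp_all add: detour_props keys m uv q)
        then show ?thesis using False dm by (simp add: transcript_def q(4))
      qed (simp add: transcript_def)
    qed
  qed
  then show "observe ?F (transcript E \<C> m' r' t) = observe ?F (transcript E \<C> m r t)"
    by (simp add: observe_def fun_eq_iff)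
qed

text \<open>The change is invisible in the key phase, so the adaptive choices of the eavesdropper,
  and with them the listened rounds, remain as they were.\<close>

lemma listened_hiding:
  assumes "\<And>u v j. {u, v} \<in> E \<Longrightarrow> j < key_rounds \<Longrightarrow>
      r' u v j = r u v j + hiding (listened r) \<delta> u v j"
  shows "listened r' = listened r"
proof -
  have "key_view r' j = key_view r j" if "j \<le> key_rounds" for j
  proof (rule key_view_cong[OF _ that])
    fix u v j assume *: "{u, v} \<in> E" "j < key_rounds" "{u, v} \<in> \<sigma> (key_view r j)"
    then have "j \<in> listened r {u, v}" by (simp add: listened_def)
    then show "r' u v j = r u v j" using assms[OF *(1,2)] hiding_props(1)[OF *(1)] by simp
  qed
  then show ?thesis by (auto simp: listened_def fun_eq_iff)
qed

end

section \<open>An involution of the coins and the law of the view\<close>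

context compiler
begin

lemma own_bit_append:
  "length a = coin_bits A \<Longrightarrow> own_bit (a @ \<rho>) z j = of_bool (\<rho> ! (z * key_rounds + j))"
  by (simp add: own_bit_def nth_append)

end

context eavesdropped
begin

definition base_rand :: "(nat \<Rightarrow> bool list) \<Rightarrow> nat \<Rightarrow> nat \<Rightarrow> nat \<Rightarrow> bit" where
  "base_rand \<rho> u z j = of_bool (\<rho> u ! (z * key_rounds + j))"

definition mask :: "(nat \<Rightarrow> nat \<Rightarrow> nat \<Rightarrow> nat \<Rightarrow> bit) \<Rightarrow> (nat \<Rightarrow> bool list) \<Rightarrow> nat \<Rightarrow> bool list" where
  "mask \<delta> \<rho> v = (if v \<in> V
     then map (\<lambda>i. (\<rho> v ! i) \<noteq>
            (hiding (listened (base_rand \<rho>)) \<delta> v (i div key_rounds) (i mod key_rounds) = 1))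
          [0..<N * key_rounds]
     else [])"

lemma base_rand_mask:
  assumes "{u, v} \<in> E" "j < key_rounds"
  shows "base_rand (mask \<delta> \<rho>) u v j = base_rand \<rho> u v j + hiding (listened (base_rand \<rho>)) \<delta> u v j"
proof -
  have "u \<in> V" "v < N" using edge_in_V[OF assms(1)] ids by simp_all
  have "v * key_rounds + j < Suc v * key_rounds" using assms(2) by simp
  also have "\<dots> \<le> N * key_rounds" using \<open>v < N\<close> by (intro mult_le_mono1) simp
  finally have "mask \<delta> \<rho> u ! (v * key_rounds + j) = (\<rho> u ! (v * key_rounds + j) \<noteq>
      (hiding (listened (base_rand \<rho>)) \<delta> u v j = 1))"
    using \<open>u \<in> V\<close> assms(2) by (simp add: mask_def)
  then show ?thesis
    by (cases "hiding (listened (base_rand \<rho>)) \<delta> u v j") (simp_all add: base_rand_def)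
qed

lemma mask_in_coin_space: "mask \<delta> \<rho> \<in> coin_space V (N * key_rounds)"
  by (auto simp: coin_space_def PiE_dflt_def mask_def)

text \<open>Masking preserves the listened rounds, so the second masking adds the same bits again
  and cancels the first.\<close>

lemma mask_mask:
  assumes "\<rho> \<in> coin_space V (N * key_rounds)"
  shows "mask \<delta> (mask \<delta> \<rho>) = \<rho>"
proof
  fix v
  have "listened (base_rand (mask \<delta> \<rho>)) = listened (base_rand \<rho>)"
    by (rule listened_hiding) (rule base_rand_mask)
  then show "mask \<delta> (mask \<delta> \<rho>) v = \<rho> v"
    using assms unfolding mask_def[of \<delta> "mask \<delta> \<rho>"]
    by (auto simp: coin_space_def PiE_dflt_def mask_def intro!: nth_equalityI)
qed

text \<open>\<open>mask\<close> preserves the uniform law and turns coins that give some view with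
  \<open>m\<close> into coins that give the same view with \<open>m'\<close>. The prefixes
  \<open>a\<close> and \<open>a'\<close> may differ, since keys are drawn from the additional coins
  only.\<close>

lemma view_distribution:
  assumes a: "a \<in> coin_space V (coin_bits A)" "a' \<in> coin_space V (coin_bits A)"
  defines "Q \<equiv> coins V (N * key_rounds)"
  shows "map_pmf (\<lambda>\<rho>. view \<sigma> (transcript E \<C> m' (\<lambda>u. own_bit (a' u @ \<rho> u))) T) Q =
    map_pmf (\<lambda>\<rho>. view \<sigma> (transcript E \<C> m (\<lambda>u. own_bit (a u @ \<rho> u))) T) Q"
proof -
  define \<delta> where "\<delta> t b u v =
    (of_bool (encode_bit (m t u v) b) + of_bool (encode_bit (m' t u v) b) :: bit)" for t b u v
  let ?X = "coin_space V (N * key_rounds)"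
  have Q: "Q = pmf_of_set ?X" "set_pmf Q = ?X"
    using finite_V by (simp_all add: Q_def coins_eq_pmf_of_set set_pmf_coins del: set_pmf_of_set)
      (simp add: finite_coin_space coin_space_nonempty)
  have "bij_betw (mask \<delta>) ?X ?X"
    by (rule bij_betwI[where g = "mask \<delta>"]) (auto simp: mask_in_coin_space mask_mask)
  then have "map_pmf (mask \<delta>) Q = Q"
    unfolding Q(1) using finite_coin_space[OF finite_V] coin_space_nonempty
    by (intro map_pmf_of_set_bij_betw) auto
  then have "map_pmf (\<lambda>\<rho>. view \<sigma> (transcript E \<C> m' (\<lambda>u. own_bit (a' u @ \<rho> u))) T) Q =
      map_pmf (\<lambda>\<rho>. view \<sigma> (transcript E \<C> m' (\<lambda>u. own_bit (a' u @ \<rho> u))) T) (map_pmf (mask \<delta>) Q)"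
    by simp
  also have "\<dots> = map_pmf (\<lambda>\<rho>. view \<sigma> (transcript E \<C> m' (\<lambda>u. own_bit (a' u @ mask \<delta> \<rho> u))) T) Q"
    unfolding map_pmf_comp ..
  also have "\<dots> = map_pmf (\<lambda>\<rho>. view \<sigma> (transcript E \<C> m (\<lambda>u. own_bit (a u @ \<rho> u))) T) Q"
  proof (intro map_pmf_cong refl)
    fix \<rho>
    have rand: "own_bit (a'' u @ \<rho>' u) v j = base_rand \<rho>' u v j"
      if "a'' \<in> coin_space V (coin_bits A)" "{u, v} \<in> E" for a'' \<rho>' u v j
    proof -
      have "length (a'' u) = coin_bits A"
        using that(1) edge_in_V[OF that(2)] by (simp add: coin_space_def PiE_dflt_def)
      then show ?thesis by (simp add: own_bit_append base_rand_def)
    qed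
    show "view \<sigma> (transcript E \<C> m' (\<lambda>u. own_bit (a' u @ mask \<delta> \<rho> u))) T =
        view \<sigma> (transcript E \<C> m (\<lambda>u. own_bit (a u @ \<rho> u))) T"
      by (rule view_hiding[where ?r0.0 = "base_rand \<rho>" and \<delta> = \<delta>])
        (simp_all only: rand[OF a(1)] rand[OF a(2)] base_rand_mask \<delta>_def
          bit_add_self_left add.commute add.left_commute)
  qed
  finally show ?thesis .
qed

lemma learns_nothing_compiled:
  assumes A: "\<And>x a. a \<in> coin_space V (coin_bits A) \<Longrightarrow>
    (\<forall>t u v. length (messages A E x a t u v) < B) \<and> halts_within A V E x a R"
  shows "learns_nothing V E \<C> A compiled_algorithm \<sigma>"
  unfolding learns_nothing_def Let_def
proof (intro allI)
  fix P :: "(nat \<Rightarrow> 'i) pmf" and T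
  let ?Q1 = "coins V (coin_bits A)" and ?Q2 = "coins V (N * key_rounds)"
  let ?run = "pair_pmf P (coins V (coin_bits compiled_algorithm))"
  let ?h = "\<lambda>((x, a), \<rho>). (x, \<lambda>v. a v @ \<rho> v)"
  let ?secret = "\<lambda>(x, \<omega>). messages A E x (coins_of A \<omega>)"
  let ?seen = "\<lambda>(x, \<omega>). view \<sigma> (messages compiled_algorithm E (with_cover \<C> x) \<omega>) T"
  let ?pp = "pair_pmf (pair_pmf P ?Q1) ?Q2"
  have run: "?run = map_pmf ?h ?pp"
    by (simp add: coins_append[OF finite_V] pair_pmf_def map_pmf_def bind_assoc_pmf bind_return_pmf)
  have exec: "compiled_execution A R B d c V E \<C> x (\<lambda>v. a v @ \<rho> v)" "coins_of A (\<lambda>v. a v @ \<rho> v) = a"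
    if "a \<in> set_pmf ?Q1" "\<rho> \<in> set_pmf ?Q2" for x a \<rho>
  proof -
    have mem: "a \<in> coin_space V (coin_bits A)" "\<rho> \<in> coin_space V (N * key_rounds)"
      using that finite_V by (simp_all add: set_pmf_coins)
    show "coins_of A (\<lambda>v. a v @ \<rho> v) = a" by (rule coins_of_append[OF mem])
    then show "compiled_execution A R B d c V E \<C> x (\<lambda>v. a v @ \<rho> v)"
      using A[OF mem(1)] by unfold_locales simp_all
  qed
  let ?f = "\<lambda>(x, a). messages A E x a"
  let ?g = "\<lambda>(x, a) \<rho>. view \<sigma> (transcript E \<C> (messages A E x a) (\<lambda>u. own_bit (a u @ \<rho> u))) T"
  have secret: "?secret (?h s) = ?f (fst s)" and seen: "?seen (?h s) = ?g (fst s) (snd s)"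
    if s: "s \<in> set_pmf ?pp" for s
  proof -
    obtain x a \<rho> where sp: "s = ((x, a), \<rho>)" by (metis prod.exhaust)
    then have mem: "a \<in> set_pmf ?Q1" "\<rho> \<in> set_pmf ?Q2" using s by auto
    show "?secret (?h s) = ?f (fst s)" by (simp add: sp exec(2)[OF mem])
    show "?seen (?h s) = ?g (fst s) (snd s)"
      using compiled_execution.messages_compiled_eq[OF exec(1)[OF mem], where N = N]
      by (simp add: sp exec(2)[OF mem])
  qed
  \<comment> \<open>An arbitrary reference: the law of the view for empty messages and coins
    \<open>a0\<close> serves as the common conditional law.\<close>
  obtain a0 where a0: "a0 \<in> coin_space V (coin_bits A)" using coin_space_nonempty by blast
  have "map_pmf (\<lambda>s. (?secret s, ?seen s)) ?run = map_pmf (\<lambda>(s, \<rho>). (?f s, ?g s \<rho>)) ?pp"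
    unfolding run map_pmf_comp using secret seen by (intro map_pmf_cong refl) (simp add: split_beta)
  also have "\<dots> = pair_pmf (map_pmf ?f (pair_pmf P ?Q1)) (map_pmf (\<lambda>(s, \<rho>). ?g s \<rho>) ?pp)"
  proof (rule independent_if_conditionals_equal)
    fix s assume "s \<in> set_pmf (pair_pmf P ?Q1)"
    then have "snd s \<in> coin_space V (coin_bits A)"
      using finite_V by (auto simp: set_pmf_coins)
    then show "map_pmf (?g s) ?Q2 =
        map_pmf (\<lambda>\<rho>. view \<sigma> (transcript E \<C> (\<lambda>_ _ _. []) (\<lambda>u. own_bit (a0 u @ \<rho> u))) T) ?Q2"
      using view_distribution[OF a0] by (simp add: split_beta)
  qed
  also have "map_pmf ?f (pair_pmf P ?Q1) = map_pmf (\<lambda>s. ?f (fst s)) ?pp"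
    by (simp add: map_fst_pair_pmf flip: map_pmf_comp[of ?f fst])
  also have "\<dots> = map_pmf ?secret ?run"
    unfolding run map_pmf_comp using secret by (intro map_pmf_cong refl) simp
  also have "map_pmf (\<lambda>(s, \<rho>). ?g s \<rho>) ?pp = map_pmf ?seen ?run"
    unfolding run map_pmf_comp using seen by (intro map_pmf_cong refl) (simp add: split_beta)
  finally show "map_pmf (\<lambda>s. (?secret s, ?seen s)) ?run =
    pair_pmf (map_pmf ?secret ?run) (map_pmf ?seen ?run)" .
qed

end

section \<open>Round overhead\<close>

lemma congest_algorithm_coin_space:
  assumes "congest_algorithm V E A R b" "finite V" "a \<in> coin_space V (coin_bits A)"
  shows "real (length (messages A E x a t u v)) \<le> b" "halts_within A V E x a R"
  using assms by (simp_all add: congest_algorithm_def bandwidth_le_def set_pmf_coins)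

text \<open>The schedule has a fixed length, so the bound on the rounds holds with probability 1,
  hence at least \<open>q\<close>.\<close>

theorem compiled_by_compiler:
  fixes A :: "('i, 'o) algorithm"
  assumes "network V E n \<kappa>'" and "cycle_cover E d c \<eta> k \<C>"
    and A: "congest_algorithm V E A R \<beta>'"
    and "real B > \<beta>'" "real N \<ge> 2 powr \<kappa>'"
    and budget: "0 < k' \<Longrightarrow> \<eta> * (8 * k') < k"
    and "1 \<le> b" "q \<le> 1" and L: "9 * real B * (real d * real c + 1) \<le> L"
  shows "compiled V E \<C> k' R b q L A (compiler.compiled_algorithm A R B N d c)"
proof -
  have graph: "simple_graph V E" and ids: "\<And>v. v \<in> V \<Longrightarrow> v < N"
    using assms(1,5) by (force simp: network_def)+
  interpret covered_graph A R B N d c V E \<C>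
    using assms(2) graph by unfold_locales (auto simp: cycle_cover_def)
  have A': "length (messages A E x a t u v) < B" "halts_within A V E x a R"
    if "a \<in> coin_space V (coin_bits A)" for x a t u v
    using congest_algorithm_coin_space[OF A finite_V that] assms(4) by (smt (verit) of_nat_less_iff)+
  have exec: "compiled_execution A R B d c V E \<C> x \<omega>"
    if "\<omega> \<in> set_pmf (coins V (coin_bits compiled_algorithm))" for x \<omega>
  proof -
    have "\<omega> \<in> coin_space V (coin_bits A + N * key_rounds)"
      using that finite_V by (simp add: set_pmf_coins)
    then have "coins_of A \<omega> \<in> coin_space V (coin_bits A)"
      by (auto simp: coin_space_def PiE_dflt_def coins_of_def)
    then show ?thesis using A' by unfold_locales simp_all
  qed
  have "learns_nothing V E \<C> A compiled_algorithm \<sigma>" if "eavesdropper E k' \<sigma>" for \<sigma>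
  proof -
    interpret eavesdropped A R B N d c V E \<C> k k' \<eta> \<sigma>
    proof
      show "\<exists>\<C>e\<subseteq>\<C>. finite \<C>e \<and> card \<C>e = k \<and> (\<forall>C\<in>\<C>e. e \<in> C) \<and>
          (\<forall>e'\<in>E - {e}. card {C \<in> \<C>e. e' \<in> C} \<le> \<eta>)" if "e \<in> E" for e
        using assms(2) that by (simp add: cycle_cover_def)
    qed (use ids that budget in auto)
    show ?thesis by (rule learns_nothing_compiled) (use A' in blast)
  qed
  moreover have "same_output V E \<C> A compiled_algorithm"
    unfolding same_output_def
    using compiled_execution.halts_within_compiled[OF exec, where N = N]
      compiled_execution.final_output_compiled[OF exec, where N = N] by blast
  ultimately have "resilient V E \<C> k' A compiled_algorithm" by (simp add: resilient_def)
  moreover have "bandwidth_le compiled_algorithm V E (with_cover \<C> x) b" for x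
    unfolding bandwidth_le_def
  proof (intro ballI allI)
    fix \<omega> t u v assume "\<omega> \<in> set_pmf (coins V (coin_bits compiled_algorithm))"
    from compiled_execution.length_messages_compiled[OF exec[OF this], where N = N]
    have "length (messages compiled_algorithm E (with_cover \<C> x) \<omega> t u v) \<le> 1" .
    then show "real (length (messages compiled_algorithm E (with_cover \<C> x) \<omega> t u v)) \<le> b"
      using \<open>1 \<le> b\<close> by linarith
  qed
  moreover have "q \<le> measure_pmf.prob (coins V (coin_bits compiled_algorithm))
      {\<omega>. \<exists>T. real T \<le> L * real R \<and>
        halts_within compiled_algorithm V E (with_cover \<C> x) \<omega> T}" (is "_ \<le> measure_pmf.prob _ ?S") for x
  proof -
    \<comment> \<open>Each slot costs 8 rounds of key exchange and 1 round of use, hence the factor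
      9.\<close>
    have "real total_rounds = 9 * real B * (real d * real c + 1) * real R"
      by (simp add: total_rounds_def key_rounds_def num_slots_def algebra_simps)
    also have "\<dots> \<le> L * real R" using L by (intro mult_right_mono) simp_all
    finally have "set_pmf (coins V (coin_bits compiled_algorithm)) \<subseteq> ?S"
      using compiled_execution.halts_within_compiled[OF exec, where N = N] by blast
    then have "measure_pmf.prob (coins V (coin_bits compiled_algorithm)) ?S = 1"
      by (subst measure_pmf.prob_eq_1) (auto simp: AE_measure_pmf_iff)
    then show ?thesis using \<open>q \<le> 1\<close> by simp
  qed
  ultimately show ?thesis by (simp add: compiled_def)
qed

text \<open>The block length exceeds \<open>\<beta> * log 2 n\<close> strictly, as the padding
  requires, and the last but two parameter bounds all IDs. Neither the graph nor the cover enters,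
  so one algorithm serves all of them.\<close>

definition logarithmic_compiler ::
  "real \<Rightarrow> real \<Rightarrow> nat \<Rightarrow> ('i, 'o) algorithm \<Rightarrow> nat \<Rightarrow> nat \<Rightarrow> nat \<Rightarrow> (cycle set \<times> 'i, 'o) algorithm" where
  "logarithmic_compiler \<beta> \<kappa> n A R d c = compiler.compiled_algorithm A R
     (nat \<lfloor>\<beta> * log 2 n\<rfloor> + 1) (nat \<lceil>2 powr (\<kappa> * log 2 n)\<rceil>) d c"

lemma compiled_logarithmic:
  assumes "0 < \<beta>" "2 \<le> n" "network V E n (\<kappa> * log 2 n)" "cycle_cover E d c \<eta> k \<C>"
    and "congest_algorithm V E A R (\<beta> * log 2 n)" "0 < k' \<Longrightarrow> \<eta> * (8 * k') < k"
    and dc: "real d * real c + 1 \<le> X" and L: "L = 9 * (\<beta> + 1) * log 2 n * X"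
  shows "compiled V E \<C> k' R (1 * log 2 n) (1 - 1 / n powr 1) L A
    (logarithmic_compiler \<beta> \<kappa> n A R d c)"
  unfolding logarithmic_compiler_def
proof (rule compiled_by_compiler[OF assms(3-5) _ _ assms(6)])
  let ?B = "nat \<lfloor>\<beta> * log 2 n\<rfloor> + 1"
  have log: "1 \<le> log 2 n" using assms(2) by simp
  then show "1 \<le> 1 * log 2 n" by simp
  have pos: "0 \<le> \<beta> * log 2 n" using log assms(1) by simp
  show "\<beta> * log 2 n < real ?B" using pos by linarith
  show "2 powr (\<kappa> * log 2 n) \<le> real (nat \<lceil>2 powr (\<kappa> * log 2 n)\<rceil>)" by linarith
  show "1 - 1 / n powr 1 \<le> 1" by simp
  have "real ?B \<le> \<beta> * log 2 n + 1" using pos by linarith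
  also have "\<dots> \<le> (\<beta> + 1) * log 2 n" using log by (simp add: algebra_simps)
  finally have "real ?B * (real d * real c + 1) \<le> (\<beta> + 1) * log 2 n * X"
    using dc pos log assms(1) by (intro mult_mono) simp_all
  then have "9 * (real ?B * (real d * real c + 1)) \<le> 9 * ((\<beta> + 1) * log 2 n * X)"
    by (rule mult_left_mono) simp
  then show "9 * real ?B * (real d * real c + 1) \<le> L" unfolding L by (simp only: mult.assoc)
qed

text \<open>\<open>l\<close> is the logarithmic factor in the bound on \<eta>, and \<open>l'\<close>
  the remaining one in the bound on \<open>k'\<close>. The constant 32 brings
  \<open>\<eta> * (8 * k')\<close> down to \<open>k / 4\<close>.\<close>

lemma budget_from_bounds:
  assumes "0 < ce" "1 \<le> l" "1 \<le> l'" "real \<eta> \<le> ce * l"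
    and k': "real k' \<le> 1 / (32 * (ce + 1)) * (real k / (l * l'))" "0 < k'"
  shows "\<eta> * (8 * k') < k div 2"
proof -
  have l: "1 \<le> l * l'" using assms(2,3) mult_mono[of 1 l 1 l'] by simp
  have "real k / (l * l') \<le> real k / 1" using l by (intro divide_left_mono) simp_all
  then have "1 / (32 * (ce + 1)) * (real k / (l * l')) \<le> 1 / 32 * real k"
    using assms(1) l by (intro mult_mono) (simp_all add: field_simps)
  \<comment> \<open>As \<open>k'\<close> is at least 1, its bound forces \<open>k\<close> to be
    large, so the rounding in \<open>k div 2\<close> does no harm.\<close>
  then have "32 \<le> k" using k' by linarith
  have "real (\<eta> * (8 * k')) = real \<eta> * (8 * real k')" by simp
  also have "\<dots> \<le> ce * l * (8 * (1 / (32 * (ce + 1)) * (real k / (l * l'))))"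
    using assms(1,2) by (intro mult_mono assms(4) k'(1)) simp_all
  also have "\<dots> = ce / (ce + 1) * (1 / l') * (real k / 4)"
  proof -
    have eq: "ce * l * (8 * (1 / (32 * e) * (real k / (l * l')))) = ce / e * (1 / l') * (real k / 4)"
      if "e \<noteq> 0" for e
      using assms(2,3) that by (simp add: field_simps)
    show ?thesis by (rule eq) (use assms(1) in simp)
  qed
  also have "\<dots> \<le> 1 * 1 * (real k / 4)"
    using assms(1-3) by (intro mult_right_mono mult_mono) (auto simp: field_simps)
  finally have "4 * (\<eta> * (8 * k')) \<le> k" by linarith
  then show ?thesis using \<open>32 \<le> k\<close> by linarith
qed

text \<open>A path of length 0 cannot join distinct vertices. This excludes \<open>D = 0\<close>,
  where the claimed overhead would vanish.\<close>

lemma not_kD_connected_0: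
  assumes "2 \<le> card V" "0 < k"
  shows "\<not> kD_connected V E k 0"
proof
  assume kD: "kD_connected V E k 0"
  have "\<not> (\<exists>x. V \<subseteq> {x})" using assms(1) card_mono[of "{_}" V] by fastforce
  then obtain u v where uv: "u \<in> V" "v \<in> V" "u \<noteq> v" by blast
  obtain P where P: "card P = k" "\<forall>p\<in>P. is_path E u v p \<and> path_length p \<le> 0"
    using kD uv unfolding kD_connected_def by metis
  then obtain p where "p \<in> P" using assms(2) by fastforce
  then have p: "p \<noteq> []" "hd p = u" "last p = v" "length p \<le> 1"
    using P(2) by (auto simp: is_path_def path_length_def)
  then have "p = [u]" by (cases p) auto
  then show False using p(3) uv(3) by simp
qed

theorem corollary7p23:
  fixes c\<^sub>\<eta> c\<^sub>d c\<^sub>c c\<^sub>k \<beta> \<kappa> :: real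
  assumes "c\<^sub>\<eta> > 0" "c\<^sub>d > 0" "c\<^sub>c > 0" "c\<^sub>k > 0" "\<beta> > 0" "\<kappa> > 0"
  shows
    "(\<exists>(\<epsilon>::real) (K::real) (p::nat) (\<beta>'::real) (\<gamma>::real).
        \<epsilon> > 0 \<and> K > 0 \<and> \<beta>' > 0 \<and> \<gamma> \<ge> 1 \<and>
        (\<forall>(n::nat) (k::nat) (D::nat) (d::nat) (c::nat) (\<eta>::nat) (k'::nat) (R::nat)
            (A :: ('i, 'o) algorithm).
           n \<ge> 2 \<longrightarrow>
           real k \<ge> c\<^sub>k * log 2 n \<longrightarrow>
           real \<eta> \<le> c\<^sub>\<eta> \<longrightarrow>
           real d \<le> c\<^sub>d * ((101 * k * ln n) ^ D * log 2 n) \<longrightarrow>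
           real c \<le> c\<^sub>c * (k * log 2 n ^ 3) \<longrightarrow>
           real k' \<le> \<epsilon> * (k / log 2 n) \<longrightarrow>
           (\<exists>A' :: (cycle set \<times> 'i, 'o) algorithm. \<forall>V E \<C>.
              network V E n (\<kappa> * log 2 n) \<longrightarrow>
              k_edge_connected V E k \<longrightarrow>
              graph_diameter V E = D \<longrightarrow>
              cycle_cover E d c \<eta> (k div 2) \<C> \<longrightarrow>
              congest_algorithm V E A R (\<beta> * log 2 n) \<longrightarrow>
              compiled V E \<C> k' R (\<beta>' * log 2 n) (1 - 1 / n powr \<gamma>)
                (K * log 2 n ^ p * ((101 * k * ln n) ^ D * k)) A A')))
     \<and>
     (\<exists>(\<epsilon>::real) (K::real) (p::nat) (\<beta>'::real) (\<gamma>::real).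
        \<epsilon> > 0 \<and> K > 0 \<and> \<beta>' > 0 \<and> \<gamma> \<ge> 1 \<and>
        (\<forall>(n::nat) (k::nat) (D::nat) (d::nat) (c::nat) (\<eta>::nat) (k'::nat) (R::nat)
            (A :: ('i, 'o) algorithm).
           n \<ge> 2 \<longrightarrow>
           real k \<ge> c\<^sub>k * log 2 n \<longrightarrow>
           real \<eta> \<le> c\<^sub>\<eta> * log 2 n \<longrightarrow>
           real d \<le> c\<^sub>d * (D * log 2 n ^ 2) \<longrightarrow>
           real c \<le> c\<^sub>c * (k * log 2 n ^ 4) \<longrightarrow>
           real k' \<le> \<epsilon> * (k / log 2 n ^ 2) \<longrightarrow>
           (\<exists>A' :: (cycle set \<times> 'i, 'o) algorithm. \<forall>V E \<C>.
              network V E n (\<kappa> * log 2 n) \<longrightarrow>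
              kD_connected V E k D \<longrightarrow>
              cycle_cover E d c \<eta> k \<C> \<longrightarrow>
              congest_algorithm V E A R (\<beta> * log 2 n) \<longrightarrow>
              compiled V E \<C> k' R (\<beta>' * log 2 n) (1 - 1 / n powr \<gamma>)
                (K * log 2 n ^ p * (D * k)) A A')))"
    (is "?part1 \<and> ?part2")
proof
  \<comment> \<open>\<open>?\<epsilon>\<close> is the constant of \<open>budget_from_bounds\<close>.
    \<open>?K\<close> combines the 9 rounds per slot, the factor \<open>\<beta> + 1\<close> from the
    block length, and the constants in the bound on \<open>d * c + 1\<close>.\<close>
  let ?\<epsilon> = "1 / (32 * (c\<^sub>\<eta> + 1))"
  let ?K = "9 * (\<beta> + 1) * (c\<^sub>d * c\<^sub>c + 1)"
  have pos: "0 < ?\<epsilon>" "0 < ?K" using assms by (auto intro!: mult_pos_pos add_pos_pos)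
  have dc: "real d * real c + 1 \<le> (c\<^sub>d * c\<^sub>c + 1) * (x * y)"
    if "real d \<le> c\<^sub>d * x" "real c \<le> c\<^sub>c * y" "1 \<le> x" "1 \<le> y" for d c :: nat and x y
  proof -
    have "real d * real c \<le> (c\<^sub>d * x) * (c\<^sub>c * y)"
      using that assms by (intro mult_mono) auto
    moreover have "1 \<le> x * y" using that mult_mono[of 1 x 1 y] by simp
    ultimately show ?thesis by (simp add: algebra_simps)
  qed
  have k_pos: "1 \<le> real k" if "c\<^sub>k * log 2 n \<le> real k" "2 \<le> n" for k n :: nat
  proof -
    have "0 < c\<^sub>k * log 2 n" using that assms by simp
    then have "0 < real k" using that(1) by linarith
    then show ?thesis by simp
  qed
  \<comment> \<open>The exponent 5 counts one logarithm from the block length, one from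
    \<open>d\<close> and three from \<open>c\<close>. Messages of one bit allow
    \<open>\<beta>' = 1\<close>.\<close>
  show ?part1
  proof (rule exI[of _ ?\<epsilon>], rule exI[of _ ?K], rule exI[of _ 5], rule exI[of _ 1], rule exI[of _ 1],
      intro conjI allI impI pos)
    fix n k D d c \<eta> k' R :: nat and A :: "('i, 'o) algorithm"
    assume n: "2 \<le> n" and k: "c\<^sub>k * log 2 n \<le> real k" and \<eta>: "real \<eta> \<le> c\<^sub>\<eta>"
      and d: "real d \<le> c\<^sub>d * ((101 * k * ln n) ^ D * log 2 n)"
      and c: "real c \<le> c\<^sub>c * (k * log 2 n ^ 3)" and k': "real k' \<le> ?\<epsilon> * (k / log 2 n)"
    let ?P = "(101 * k * ln n) ^ D"
    have log: "1 \<le> log 2 n" using n by simp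
    have k1: "1 \<le> real k" by (rule k_pos[OF k n])
    have "ln 2 \<le> ln (real n)" using n by simp
    \<comment> \<open>This makes the base \<open>101 * k * ln n\<close> at least 1, so that its
      power is at least 1 for every \<open>D\<close>.\<close>
    then have "1 / 2 \<le> ln (real n)" using ln2_ge_two_thirds by linarith
    then have "1 \<le> 101 * k * ln n"
      using mult_mono[of 1 "real k" "1/2" "ln n"] k1 by simp
    then have P: "1 \<le> ?P" by (rule one_le_power)
    have "1 \<le> ?P * log 2 n" "1 \<le> real k * log 2 n ^ 3"
      using P k1 log mult_mono[of 1 ?P 1 "log 2 n"] mult_mono[of 1 "real k" 1 "log 2 n ^ 3"]
        one_le_power[OF log, of 3] by simp_all
    note dc = dc[OF d c this]
    have budget: "\<eta> * (8 * k') < k div 2" if "0 < k'"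
      using assms(1) log \<eta> k' that by (intro budget_from_bounds[of c\<^sub>\<eta> 1 "log 2 n"]) simp_all
    show "\<exists>A' :: (cycle set \<times> 'i, 'o) algorithm. \<forall>V E \<C>. network V E n (\<kappa> * log 2 n) \<longrightarrow>
      k_edge_connected V E k \<longrightarrow> graph_diameter V E = D \<longrightarrow> cycle_cover E d c \<eta> (k div 2) \<C> \<longrightarrow>
      congest_algorithm V E A R (\<beta> * log 2 n) \<longrightarrow>
      compiled V E \<C> k' R (1 * log 2 n) (1 - 1 / n powr 1) (?K * log 2 n ^ 5 * (?P * k)) A A'"
    proof (rule exI[of _ "logarithmic_compiler \<beta> \<kappa> n A R d c"], intro allI impI)
      fix V E \<C>
      assume "network V E n (\<kappa> * log 2 n)" "cycle_cover E d c \<eta> (k div 2) \<C>"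
        "congest_algorithm V E A R (\<beta> * log 2 n)"
      then show "compiled V E \<C> k' R (1 * log 2 n) (1 - 1 / n powr 1) (?K * log 2 n ^ 5 * (?P * k)) A
          (logarithmic_compiler \<beta> \<kappa> n A R d c)"
        by (rule compiled_logarithmic[OF assms(5) n _ _ _ budget dc])
          (simp_all add: power_numeral_reduce ac_simps)
    qed
  qed simp_all
  \<comment> \<open>The exponent 7 counts one logarithm from the block length, two from
    \<open>d\<close> and four from \<open>c\<close>.\<close>
  show ?part2
  proof (rule exI[of _ ?\<epsilon>], rule exI[of _ ?K], rule exI[of _ 7], rule exI[of _ 1], rule exI[of _ 1],
      intro conjI allI impI pos)
    fix n k D d c \<eta> k' R :: nat and A :: "('i, 'o) algorithm"
    assume n: "2 \<le> n" and k: "c\<^sub>k * log 2 n \<le> real k" and \<eta>: "real \<eta> \<le> c\<^sub>\<eta> * log 2 n"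
      and d: "real d \<le> c\<^sub>d * (D * log 2 n ^ 2)"
      and c: "real c \<le> c\<^sub>c * (k * log 2 n ^ 4)" and k': "real k' \<le> ?\<epsilon> * (k / log 2 n ^ 2)"
    have log: "1 \<le> log 2 n" using n by simp
    have k1: "1 \<le> real k" by (rule k_pos[OF k n])
    have budget: "\<eta> * (8 * k') < k" if "0 < k'"
    proof -
      have "\<eta> * (8 * k') < k div 2"
        using assms(1) log \<eta> k' that
        by (intro budget_from_bounds[of c\<^sub>\<eta> "log 2 n" "log 2 n"]) (simp_all add: power2_eq_square)
      then show ?thesis by linarith
    qed
    show "\<exists>A' :: (cycle set \<times> 'i, 'o) algorithm. \<forall>V E \<C>. network V E n (\<kappa> * log 2 n) \<longrightarrow>
      kD_connected V E k D \<longrightarrow> cycle_cover E d c \<eta> k \<C> \<longrightarrow>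
      congest_algorithm V E A R (\<beta> * log 2 n) \<longrightarrow>
      compiled V E \<C> k' R (1 * log 2 n) (1 - 1 / n powr 1) (?K * log 2 n ^ 7 * (D * k)) A A'"
    proof (rule exI[of _ "logarithmic_compiler \<beta> \<kappa> n A R d c"], intro allI impI)
      fix V E \<C>
      assume net: "network V E n (\<kappa> * log 2 n)" and kD: "kD_connected V E k D"
        and cover: "cycle_cover E d c \<eta> k \<C>" "congest_algorithm V E A R (\<beta> * log 2 n)"
      have "\<not> kD_connected V E k 0"
        using net n k1 by (intro not_kD_connected_0) (auto simp: network_def)
      then have "D \<noteq> 0" using kD by metis
      then have D: "1 \<le> real D" by simp
      have "1 \<le> real D * log 2 n ^ 2" "1 \<le> real k * log 2 n ^ 4"
        using D k1 mult_mono[of 1 "real D" 1 "log 2 n ^ 2"] mult_mono[of 1 "real k" 1 "log 2 n ^ 4"]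
          one_le_power[OF log, of 2] one_le_power[OF log, of 4] by simp_all
      note dc = dc[OF d c this]
      show "compiled V E \<C> k' R (1 * log 2 n) (1 - 1 / n powr 1) (?K * log 2 n ^ 7 * (D * k)) A
          (logarithmic_compiler \<beta> \<kappa> n A R d c)"
        using net cover
        by (rule compiled_logarithmic[OF assms(5) n _ _ _ budget dc])
          (simp_all add: power_numeral_reduce ac_simps)
    qed
  qed simp_all
qed

end
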